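(* Let $r\geq 1$ and let $\{(\alpha_i,\beta_i) : 1\le i\le r\}$ be a finite set of pairs of real numbers with $\alpha_i>0$ such that all the $\alpha_i$ and $\beta_i$, $1\le i\le r$, lie in the same quadratic field. Then Graham's problem is decidable for $\{(\alpha_i,\beta_i) : 1\le i\le r\}$; that is, there is an algorithm that, given such a set, decides whether every sufficiently large integer belongs to exactly one of the sets $S(\alpha_i,\beta_i)$, $1\le i\le r$.
   Context: For real numbers $\alpha>0$ and $\beta$, define $S(\alpha,\beta)=\{\lfloor\alpha n+\beta\rfloor : n\ge 1\}$, where $n$ ranges over integers. The numbers $\alpha_i,\beta_i$ are given explicitly as elements of a real quadratic field (rational coordinates with respect to a basis). Graham's problem asks for which finite sets of pairs every sufficiently large integer belongs to exactly one $S(\alpha_i,\beta_i)$ (such a set is called an eventual covering family). *)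

theory Defs
  imports
    "HOL-Analysis.Analysis"
    "HOL-Computational_Algebra.Nth_Powers"
    "HOL-Library.Nat_Bijection"
begin

text \<open>Kleene's partial recursive functions. A term is an algorithm;
  \<open>rec_eval f xs y\<close> says that \<open>f\<close> halts on the arguments \<open>xs\<close> with output \<open>y\<close>.\<close>

datatype recf =
    Zero
  | Succ
  | Proj nat
  | Comp recf "recf list"
  | Prec recf recf
  | Mu recf

inductive rec_eval :: "recf \<Rightarrow> nat list \<Rightarrow> nat \<Rightarrow> bool" where
  Zero: "rec_eval Zero xs 0"
| Succ: "rec_eval Succ [x] (Suc x)"
| Proj: "i < length xs \<Longrightarrow> rec_eval (Proj i) xs (xs ! i)"
| Comp: "list_all2 (\<lambda>g y. rec_eval g xs y) gs ys \<Longrightarrow> rec_eval f ys z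
    \<Longrightarrow> rec_eval (Comp f gs) xs z"
| Prec_0: "rec_eval f xs y \<Longrightarrow> rec_eval (Prec f g) (0 # xs) y"
| Prec_Suc: "rec_eval (Prec f g) (n # xs) y \<Longrightarrow> rec_eval g (n # y # xs) z
    \<Longrightarrow> rec_eval (Prec f g) (Suc n # xs) z"
| Mu: "rec_eval f (n # xs) 0 \<Longrightarrow> (\<And>m. m < n \<Longrightarrow> \<exists>y. rec_eval f (m # xs) (Suc y))
    \<Longrightarrow> rec_eval (Mu f) xs n"

inductive_cases rec_eval_ZeroE: "rec_eval Zero xs y"
inductive_cases rec_eval_SuccE: "rec_eval Succ xs y"
inductive_cases rec_eval_ProjE: "rec_eval (Proj i) xs y"
inductive_cases rec_eval_CompE: "rec_eval (Comp f gs) xs y"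
inductive_cases rec_eval_Prec0E: "rec_eval (Prec f g) (0 # xs) y"
inductive_cases rec_eval_PrecSucE: "rec_eval (Prec f g) (Suc n # xs) y"
inductive_cases rec_eval_MuE: "rec_eval (Mu f) xs y"

lemma rec_eval_deterministic:
  "rec_eval f xs y \<Longrightarrow> rec_eval f xs z \<Longrightarrow> y = z"
proof (induction f xs y arbitrary: z rule: rec_eval.induct)
  case (Comp xs gs ys f w)
  from Comp.prems obtain ys' where ys': "list_all2 (\<lambda>g y. rec_eval g xs y) gs ys'"
    and z: "rec_eval f ys' z"
    by (blast elim: rec_eval_CompE)
  have "ys = ys'"
    using Comp.IH(1) ys' by (intro nth_equalityI) (simp_all add: list_all2_conv_all_nth)
  then show ?case
    using Comp.IH(2) z by simp
next
  case (Mu f n xs)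
  from Mu.prems have z: "rec_eval f (z # xs) 0"
    and less: "\<And>m. m < z \<Longrightarrow> \<exists>y. rec_eval f (m # xs) (Suc y)"
    by (fast elim: rec_eval_MuE)+
  have "\<not> n < z"
    using less[of n] Mu.IH(1) by blast
  moreover have "\<not> z < n"
    using Mu.IH(2)[of z] z by blast
  ultimately show ?case
    by simp
qed (blast elim: rec_eval_ZeroE rec_eval_SuccE rec_eval_ProjE
      rec_eval_Prec0E rec_eval_PrecSucE)+

definition S :: "real \<Rightarrow> real \<Rightarrow> int set" where
  "S \<alpha> \<beta> = {\<lfloor>\<alpha> * of_int n + \<beta>\<rfloor> | n :: int. n \<ge> 1}"

definition eventual_covering_family :: "(real \<times> real) set \<Rightarrow> bool" where
  "eventual_covering_family P \<longleftrightarrow>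
    (\<exists>N\<^sub>0. \<forall>N\<ge>N\<^sub>0. \<exists>!p. p \<in> P \<and> N \<in> S (fst p) (snd p))"

text \<open>The elements \<open>a + b\<surd>d\<close> of the field generated by \<open>\<surd>d\<close>, given by their rational coordinates
  \<open>(a, b)\<close>. Every real quadratic field arises from some nonsquare natural number \<open>d\<close>.\<close>

definition qf_elem :: "nat \<Rightarrow> rat \<times> rat \<Rightarrow> real" where
  "qf_elem d q = of_rat (fst q) + of_rat (snd q) * sqrt (real d)"

definition quadratic_field :: "nat \<Rightarrow> real set" where
  "quadratic_field d = range (qf_elem d)"

type_synonym coord_pair = "(rat \<times> rat) \<times> (rat \<times> rat)"

definition qf_pair :: "nat \<Rightarrow> coord_pair \<Rightarrow> real \<times> real" where
  "qf_pair d = map_prod (qf_elem d) (qf_elem d)"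

text \<open>The input handed to the algorithm: a natural number coding \<open>d\<close> and a list of coordinates.
  A rational is coded by its numerator and denominator in lowest terms.\<close>

definition rat_code :: "rat \<Rightarrow> nat" where
  "rat_code q = prod_encode (int_encode (fst (quotient_of q)), int_encode (snd (quotient_of q)))"

definition qf_code :: "rat \<times> rat \<Rightarrow> nat" where
  "qf_code q = prod_encode (rat_code (fst q), rat_code (snd q))"

definition coord_pair_code :: "coord_pair \<Rightarrow> nat" where
  "coord_pair_code p = prod_encode (qf_code (fst p), qf_code (snd p))"

definition input_code :: "nat \<Rightarrow> coord_pair list \<Rightarrow> nat" where
  "input_code d ps = prod_encode (d, list_encode (map coord_pair_code ps))"

lemma rat_code_inject [simp]: "rat_code p = rat_code q \<longleftrightarrow> p = q"
  by (auto simp: rat_code_def int_encode_eq intro!: quotient_of_inject prod_eqI)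

lemma qf_code_inject [simp]: "qf_code p = qf_code q \<longleftrightarrow> p = q"
  by (auto simp: qf_code_def prod_eq_iff)

lemma coord_pair_code_inject [simp]: "coord_pair_code p = coord_pair_code q \<longleftrightarrow> p = q"
  by (auto simp: coord_pair_code_def prod_eq_iff)

lemma input_code_inject: "input_code d ps = input_code e qs \<longleftrightarrow> d = e \<and> ps = qs"
proof -
  have "inj coord_pair_code"
    by (simp add: inj_def)
  then show ?thesis
    by (simp add: input_code_def list_encode_eq inj_map_eq_map)
qed

end

theory Submission
  imports Defs
begin

text \<open>Put \<open>\<gamma> = 1 / \<alpha>\<close> and \<open>\<delta> = \<beta> / \<alpha>\<close>. Beyond \<open>\<beta>\<close>, an integer \<open>N\<close> lies in \<open>S \<alpha> \<beta>\<close> iff an integer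
  lies in \<open>[N \<gamma> - \<delta>, (N + 1) \<gamma> - \<delta>)\<close>. If \<open>D\<close> is a common denominator of all coordinates and
  \<open>N = D M + t\<close>, this depends only on \<open>t\<close> and on \<open>M \<surd>d\<close> modulo 1, and as a function of
  \<open>x = M \<surd>d\<close> it is locally constant off a set of breakpoints, which are numbers of bounded height
  in the field. Distinct breakpoints are separated by an explicit distance (Liouville), and \<open>M \<surd>d\<close> is
  not a breakpoint once \<open>M\<close> is large. By Dirichlet approximation, every sufficiently long run of
  consecutive \<open>M\<close>, with an explicit bound on the length, brings \<open>M \<surd>d\<close> modulo 1 into a given interval
  free of breakpoints. So each pattern of memberships that occurs at one large \<open>N\<close> recurs in every
  window of an explicit length, and it suffices to test one window computed from the input.\<close>

section \<open>Recurrence of the membership patterns\<close>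

text \<open>Irrationality of \<surd>d: squaring gives \<open>p\<^sup>2 = q\<^sup>2 * int d\<close>,
  and for \<open>q \<noteq> 0\<close> divisibility of squares yields \<open>p = q * k\<close>, so
  that \<open>d\<close> would be the square of \<open>k\<close>.\<close>

lemma int_coords_eq_0:
  fixes p q :: int
  assumes "\<not> is_square d" "of_int p + of_int q * sqrt (real d) = 0"
  shows "p = 0 \<and> q = 0"
proof -
  have "(of_int p :: real) = - (of_int q * sqrt (real d))"
    using assms(2) by simp
  then have "(of_int p :: real)\<^sup>2 = (of_int q * sqrt (real d))\<^sup>2"
    by simp
  then have "(of_int (p\<^sup>2) :: real) = of_int (q\<^sup>2 * int d)"
    by (simp add: power_mult_distrib)
  then have eq: "p\<^sup>2 = q\<^sup>2 * int d"
    by linarith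
  have "q = 0"
  proof (rule ccontr)
    assume "q \<noteq> 0"
    have "q\<^sup>2 dvd p\<^sup>2" using eq by simp
    then obtain k where "p = q * k" by (auto simp: pow_divides_pow_iff)
    then have "q\<^sup>2 * k\<^sup>2 = q\<^sup>2 * int d" using eq by (simp add: power_mult_distrib)
    then have "k\<^sup>2 = int d" using \<open>q \<noteq> 0\<close> by simp
    then have "(nat \<bar>k\<bar>)\<^sup>2 = d"
      by (metis abs_ge_zero int_eq_iff nat_power_eq power2_abs)
    then show False using assms(1) by (metis is_nth_power_nth_power)
  qed
  then show ?thesis using eq by simp
qed

text \<open>The product of the two conjugates is the norm
  \<open>p\<^sup>2 - q\<^sup>2 * int d\<close>, a nonzero integer.\<close>

lemma liouville_quadratic:
  fixes p q :: int
  assumes "\<not> is_square d" "of_int p + of_int q * sqrt (real d) \<noteq> 0"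
  shows "1 \<le> \<bar>of_int p + of_int q * sqrt (real d)\<bar> * \<bar>of_int p - of_int q * sqrt (real d)\<bar>"
proof -
  have conj: "of_int p - of_int q * sqrt (real d) \<noteq> 0"
    using int_coords_eq_0[OF assms(1), of p "-q"] assms(2) by auto
  have eq: "(of_int p + of_int q * sqrt (real d)) * (of_int p - of_int q * sqrt (real d))
      = of_int (p\<^sup>2 - q\<^sup>2 * int d)"
    by (simp add: algebra_simps power2_eq_square)
  then have "p\<^sup>2 - q\<^sup>2 * int d \<noteq> 0"
    using conj assms(2) by (metis mult_eq_0_iff of_int_0)
  then have "1 \<le> \<bar>p\<^sup>2 - q\<^sup>2 * int d\<bar>" by linarith
  then have "1 \<le> \<bar>(of_int (p\<^sup>2 - q\<^sup>2 * int d) :: real)\<bar>" by linarith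
  then show ?thesis by (simp only: eq[symmetric] abs_mult)
qed

lemma sqrt_le_self_nat: "sqrt (real d) \<le> real d"
  by (cases "d = 0") (auto intro!: real_le_lsqrt simp: power2_eq_square)

section \<open>Breakpoints of bounded height and their spacing\<close>

definition breakpoints :: "nat \<Rightarrow> nat \<Rightarrow> real set" where
  "breakpoints d H = {z. \<exists>(c :: int) (p :: int) (q :: int). c \<noteq> 0 \<and> \<bar>c\<bar> \<le> int H \<and> \<bar>q\<bar> \<le> int H \<and>
     of_int c * z = of_int p + of_int q * sqrt (real d)}"

text \<open>Clearing denominators turns the difference into \<open>P + Q \<surd>d\<close> with
  \<open>Q\<close> of size at most \<open>2 H\<^sup>2\<close>, to which the norm inequality applies.
  The coefficient \<open>p\<close> is unbounded, which makes the set invariant under integer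
  translations, so the conjugate has to be bounded without a bound on \<open>P\<close>.\<close>

lemma breakpoints_separated:
  assumes ns: "\<not> is_square d" and z: "z \<in> breakpoints d H" "z' \<in> breakpoints d H" "z \<noteq> z'"
  shows "1 \<le> real (H ^ 4 * (1 + 4 * d)) * \<bar>z - z'\<bar>"
proof -
  let ?r = "sqrt (real d)"
  obtain c p q where z1: "c \<noteq> 0" "\<bar>c\<bar> \<le> int H" "\<bar>q\<bar> \<le> int H" "of_int c * z = of_int p + of_int q * ?r"
    using z(1) unfolding breakpoints_def by blast
  obtain c' p' q' where z2: "c' \<noteq> 0" "\<bar>c'\<bar> \<le> int H" "\<bar>q'\<bar> \<le> int H"
    "of_int c' * z' = of_int p' + of_int q' * ?r"
    using z(2) unfolding breakpoints_def by blast
  have H1: "H \<ge> 1" using z1 by linarith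
  then have H41: "real (H ^ 4) \<ge> 1" by (metis of_nat_1 of_nat_mono one_le_power)
  define P where "P = p * c' - p' * c"
  define Q where "Q = q * c' - q' * c"
  have "of_int P + of_int Q * ?r = of_int c' * (of_int p + of_int q * ?r) - of_int c * (of_int p' + of_int q' * ?r)"
    by (simp add: P_def Q_def algebra_simps)
  also have "\<dots> = of_int c' * (of_int c * z) - of_int c * (of_int c' * z')"
    by (simp only: z1(4)[symmetric] z2(4)[symmetric])
  also have "\<dots> = of_int (c * c') * (z - z')"
    by (simp add: algebra_simps)
  finally have PQ: "of_int P + of_int Q * ?r = of_int (c * c') * (z - z')" .
  have cc: "\<bar>c * c'\<bar> \<le> int H * int H"
    unfolding abs_mult using z1 z2 by (intro mult_mono) auto
  then have "of_int \<bar>c * c'\<bar> \<le> (of_int (int H * int H) :: real)" by (simp only: of_int_le_iff)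
  then have ccr: "\<bar>of_int (c * c') :: real\<bar> \<le> real (H\<^sup>2)" by (simp add: power2_eq_square)
  have a: "\<bar>q * c'\<bar> \<le> int H * int H" "\<bar>q' * c\<bar> \<le> int H * int H"
    unfolding abs_mult using z1 z2 by (auto intro!: mult_mono)
  have "\<bar>Q\<bar> \<le> int (2 * H\<^sup>2)" using a by (simp add: Q_def power2_eq_square)
  then have "of_int \<bar>Q\<bar> \<le> (of_int (int (2 * H\<^sup>2)) :: real)" by (simp only: of_int_le_iff)
  then have Qr: "\<bar>of_int Q :: real\<bar> \<le> 2 * real (H\<^sup>2)" by simp
  have Qr2: "\<bar>of_int Q * ?r\<bar> \<le> 2 * real (H\<^sup>2) * real d"
    unfolding abs_mult using Qr sqrt_le_self_nat[of d] by (intro mult_mono) auto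
  show ?thesis
  proof (cases "\<bar>z - z'\<bar> \<le> 1")
    \<comment> \<open>For close points \<open>P + Q \<surd>d\<close> is itself at most
      \<open>H\<^sup>2\<close>, and the conjugate differs from it by \<open>2 Q \<surd>d\<close>.
      This controls the conjugate although \<open>P\<close> is unrestricted.\<close>
    case True
    have ub: "\<bar>of_int P + of_int Q * ?r\<bar> \<le> real (H\<^sup>2) * \<bar>z - z'\<bar>"
      unfolding PQ abs_mult[of _ "z - z'"] using ccr by (intro mult_right_mono) auto
    also have "\<dots> \<le> real (H\<^sup>2)" using True by (simp add: mult_left_le)
    finally have "\<bar>of_int P - of_int Q * ?r\<bar> \<le> real (H\<^sup>2) + 2 * (2 * real (H\<^sup>2) * real d)"
      using Qr2 by linarith
    then have ub2: "\<bar>of_int P - of_int Q * ?r\<bar> \<le> real (H\<^sup>2) * real (1 + 4 * d)"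
      by (simp add: algebra_simps)
    have "of_int P + of_int Q * ?r \<noteq> 0" unfolding PQ using z1 z2 z(3) by simp
    then have "1 \<le> \<bar>of_int P + of_int Q * ?r\<bar> * \<bar>of_int P - of_int Q * ?r\<bar>"
      by (rule liouville_quadratic[OF ns])
    also have "\<dots> \<le> (real (H\<^sup>2) * \<bar>z - z'\<bar>) * (real (H\<^sup>2) * real (1 + 4 * d))"
      using ub ub2 by (intro mult_mono) auto
    also have "\<dots> = real (H ^ 4 * (1 + 4 * d)) * \<bar>z - z'\<bar>"
      by (simp add: power2_eq_square power4_eq_xxxx algebra_simps)
    finally show ?thesis .
  next
    case False
    have "1 \<le> real (H ^ 4) * real (1 + 4 * d)" using H41 mult_mono[of 1 "real (H^4)" 1 "real (1+4*d)"] by simp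
    then have "1 * 1 \<le> (real (H ^ 4) * real (1 + 4 * d)) * \<bar>z - z'\<bar>"
      using False by (intro mult_mono) auto
    then show ?thesis by (simp only: of_nat_mult mult_1)
  qed
qed

text \<open>Comparing the coefficients of \<surd>d gives \<open>q = c * int M\<close>, whose
  absolute value is at least \<open>M\<close> and hence exceeds the permitted height.\<close>

lemma multiple_not_breakpoint:
  assumes ns: "\<not> is_square d" and "M > H"
  shows "real M * sqrt (real d) \<notin> breakpoints d H"
proof
  assume "real M * sqrt (real d) \<in> breakpoints d H"
  then obtain c p q where z: "c \<noteq> 0" "\<bar>q\<bar> \<le> int H"
    "of_int c * (real M * sqrt (real d)) = of_int p + of_int q * sqrt (real d)"
    unfolding breakpoints_def by blast
  then have "of_int (- p) + of_int (c * int M - q) * sqrt (real d) = 0"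
    by (simp add: algebra_simps)
  then have "q = c * int M" using int_coords_eq_0[OF ns] by fastforce
  then have "\<bar>q\<bar> = \<bar>c\<bar> * int M" by (simp add: abs_mult)
  moreover have "1 * int M \<le> \<bar>c\<bar> * int M" using z(1) by (intro mult_right_mono) auto
  ultimately show False using z(2) assms(2) by linarith
qed

text \<open>A point off a \<open>2 e\<close>-separated set has a full interval of length \<open>e\<close> free of the set on one of
  its two sides.\<close>

lemma separated_gap:
  fixes Z :: "real set"
  assumes "x \<notin> Z" "e > 0" "\<And>z z'. z \<in> Z \<Longrightarrow> z' \<in> Z \<Longrightarrow> z \<noteq> z' \<Longrightarrow> 2 * e < \<bar>z - z'\<bar>"
  obtains a where "x \<in> {a..a + e}" "{a..a + e} \<inter> Z = {}"
proof (cases "{x - e..x} \<inter> Z = {}")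
  case True
  then show ?thesis using that[of "x - e"] assms(2) by simp
next
  case False
  \<comment> \<open>A point of \<open>Z\<close> within \<open>e\<close> to the left of
    \<open>x\<close> excludes any point of \<open>Z\<close> within \<open>e\<close> to the right,
    since the two would be at most \<open>2 * e\<close> apart.\<close>
  then obtain z where z: "z \<in> Z" "x - e \<le> z" "z \<le> x" by auto
  then have zx: "z < x" using assms(1) by (cases "z = x") auto
  have "{x..x + e} \<inter> Z = {}"
  proof -
    have False if "z' \<in> Z" "x \<le> z'" "z' \<le> x + e" for z'
      using assms(3)[of z z'] z zx that by auto
    then show ?thesis by auto
  qed
  then show ?thesis using that[of x] assms(2) by simp
qed

text \<open>If the two ceilings differed, the affine map would take the smaller ceiling as a value
  somewhere between \<open>x\<close> and \<open>y\<close>, hence an integer value inside the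
  interval.\<close>

lemma ceiling_constant_on_gap:
  fixes B c :: real
  assumes "x \<in> {a..b}" "y \<in> {a..b}" "\<And>z. B \<noteq> 0 \<Longrightarrow> z \<in> {a..b} \<Longrightarrow> B * z + c \<notin> \<int>"
  shows "\<lceil>B * x + c\<rceil> = \<lceil>B * y + c\<rceil>"
proof -
  have *: False if xy: "x \<in> {a..b}" "y \<in> {a..b}" "\<lceil>B * x + c\<rceil> < \<lceil>B * y + c\<rceil>" for x y
  proof -
    define k where "k = \<lceil>B * x + c\<rceil>"
    have k: "B * x + c \<le> of_int k" "of_int k < B * y + c"
      using xy(3) unfolding k_def by (auto simp: less_ceiling_iff)
    then have B: "B \<noteq> 0" by auto
    define z where "z = (of_int k - c) / B"
    have z: "B * z + c = of_int k" using B by (simp add: z_def)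
    have "B * x \<le> B * z" "B * z < B * y" using k z by auto
    then have "z \<in> {a..b}" using xy B by (cases "B > 0") (auto simp: mult_le_cancel_left mult_less_cancel_left)
    then show False using assms(3)[OF B, of z] by (simp add: z)
  qed
  show ?thesis using *[OF assms(1,2)] *[OF assms(2,1)] by (meson linorder_neqE)
qed

text \<open>Dirichlet gives \<open>k \<le> K\<close> for which adding \<open>k\<close> to the
  multiplier moves the point modulo 1 by some nonzero \<open>s\<close> shorter than the target
  interval, so steps of \<open>s\<close> cannot jump over it. The norm inequality bounds
  \<open>s\<close> from below and thus the number of steps needed to traverse a unit length by
  \<open>2 * K * d + 2\<close>; each step costs at most \<open>K\<close>.\<close>

lemma multiples_dense:
  assumes ns: "\<not> is_square d" and K: "K > 0"
  obtains M k where "m \<le> M" "M \<le> m + (2 * K * d + 2) * K"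
    "real M * sqrt (real d) + of_int k \<in> {a..a + 1 / real K}"
proof -
  note found = that
  let ?r = "sqrt (real d)"
  obtain h k where hk: "0 < k" "k \<le> int K" "\<bar>of_int k * ?r - of_int h\<bar> < 1 / real K"
    using Dirichlet_approx[OF K, of ?r] by blast
  define s where "s = of_int k * ?r - of_int h"
  have sK: "\<bar>s\<bar> < 1 / real K" using hk by (simp add: s_def)
  also have "\<dots> \<le> 1" using K by simp
  finally have s1: "\<bar>s\<bar> < 1" .
  have sh: "s = of_int (- h) + of_int k * ?r" by (simp add: s_def)
  have s0: "s \<noteq> 0" using int_coords_eq_0[OF ns, of "-h" k] hk(1) unfolding sh by auto
  have kr: "0 \<le> of_int k * ?r" "of_int k * ?r \<le> real K * real d"
    using hk sqrt_le_self_nat[of d] by (auto intro!: mult_mono)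
  have "1 \<le> \<bar>s\<bar> * \<bar>of_int (- h) - of_int k * ?r\<bar>"
    using liouville_quadratic[OF ns, of "-h" k] s0 unfolding sh by simp
  \<comment> \<open>The conjugate equals \<open>s - 2 k \<surd>d\<close>, where \<open>s\<close> is
    below 1 in absolute value.\<close>
  also have "\<dots> \<le> \<bar>s\<bar> * (2 * real K * real d + 1)"
    using s1 kr unfolding s_def by (intro mult_left_mono) auto
  finally have lb: "1 \<le> \<bar>s\<bar> * (2 * real K * real d + 1)" .
  have inv: "1 / \<bar>s\<bar> \<le> 2 * real K * real d + 1" using lb s0 by (simp add: divide_simps mult.commute)
  have step: "real (m + j * nat k) * ?r + of_int (l - int j * h) = (real m * ?r + of_int l) + real j * s" for j l
    using hk(1) by (simp add: s_def algebra_simps)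
  have fin: ?thesis if j: "real j \<le> 1 / \<bar>s\<bar> + 1"
    and mem: "(real m * ?r + of_int l) + real j * s \<in> {a..a + 1 / real K}" for j l
  proof -
    have "real j \<le> real (2 * K * d + 2)" using j inv by simp
    then have "j \<le> 2 * K * d + 2" by linarith
    moreover have "nat k \<le> K" using hk by simp
    ultimately have "j * nat k \<le> (2 * K * d + 2) * K" by (rule mult_le_mono)
    then show ?thesis
      using found[of "m + j * nat k" "l - int j * h"] mem unfolding step by simp
  qed
  show ?thesis
  proof (cases "s > 0")
    case True
    \<comment> \<open>The integer shift places the starting point \<open>y\<close> at most one unit
      to the left of the target; upward steps then reach it.\<close>
    define l where "l = \<lfloor>a - real m * ?r\<rfloor>"
    define y where "y = real m * ?r + of_int l"
    have y: "y \<le> a" "a < y + 1" unfolding y_def l_def by linarith+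
    define j where "j = nat \<lceil>(a - y) / s\<rceil>"
    have c: "of_int \<lceil>(a - y) / s\<rceil> \<ge> (a - y) / s" "of_int \<lceil>(a - y) / s\<rceil> < (a - y) / s + 1" by linarith+
    have "(a - y) / s \<ge> 0" using y True by simp
    then have jr: "real j = of_int \<lceil>(a - y) / s\<rceil>" unfolding j_def by simp
    have t1: "a - y \<le> real j * s" using c(1) jr True by (simp only: pos_divide_le_eq)
    have "real j - 1 < (a - y) / s" using c(2) jr by simp
    then have "(real j - 1) * s < a - y" using True by (simp only: pos_less_divide_eq)
    then have "real j * s < a - y + s" by (simp add: algebra_simps)
    then have "y + real j * s \<in> {a..a + 1 / real K}" using t1 sK by auto
    moreover have "(a - y) / s \<le> 1 / s" using y True by (intro divide_right_mono) auto
    then have "real j \<le> 1 / \<bar>s\<bar> + 1" using c jr True by simp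
    ultimately show ?thesis using fin[of j l] by (simp add: y_def)
  next
    case False
    then have neg: "s < 0" using s0 by simp
    \<comment> \<open>For negative \<open>s\<close> the picture is mirrored: the start lies less
      than one unit above the right endpoint \<open>b\<close>, and steps of length \<open>t\<close>
      descend into the target.\<close>
    define b where "b = a + 1 / real K"
    define l where "l = \<lceil>b - real m * ?r\<rceil>"
    define y where "y = real m * ?r + of_int l"
    have y: "b \<le> y" "y < b + 1" unfolding y_def l_def by linarith+
    define t where "t = - s"
    have t: "t > 0" using neg by (simp add: t_def)
    define j where "j = nat \<lceil>(y - b) / t\<rceil>"
    have c: "of_int \<lceil>(y - b) / t\<rceil> \<ge> (y - b) / t" "of_int \<lceil>(y - b) / t\<rceil> < (y - b) / t + 1" by linarith+
    have "(y - b) / t \<ge> 0" using y t by simp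
    then have jr: "real j = of_int \<lceil>(y - b) / t\<rceil>" unfolding j_def by simp
    have t1: "y - b \<le> real j * t" using c(1) jr t by (simp only: pos_divide_le_eq)
    have "real j - 1 < (y - b) / t" using c(2) jr by simp
    then have "(real j - 1) * t < y - b" using t by (simp only: pos_less_divide_eq)
    then have t2: "real j * t < y - b + t" by (simp add: algebra_simps)
    have t4: "y + real j * s = y - real j * t" by (simp add: t_def)
    have t5: "t < 1 / real K" using sK neg by (simp add: t_def)
    have "y + real j * s \<le> b" unfolding t4 using t1 by linarith
    moreover have "b - 1 / real K \<le> y + real j * s" unfolding t4 using t2 t5 by linarith
    ultimately have "y + real j * s \<in> {a..a + 1 / real K}" by (simp add: b_def)
    moreover have "(y - b) / t \<le> 1 / t" using y t by (intro divide_right_mono) auto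
    then have "real j \<le> 1 / \<bar>s\<bar> + 1" using c jr neg t by (simp add: t_def)
    ultimately show ?thesis using fin[of j l] by (simp add: y_def)
  qed
qed

section \<open>Membership in terms of ceilings, and its recurrence\<close>

definition hits :: "real \<Rightarrow> real \<Rightarrow> int \<Rightarrow> bool" where
  "hits \<gamma> \<delta> N \<longleftrightarrow> \<lceil>of_int N * \<gamma> - \<delta>\<rceil> \<noteq> \<lceil>of_int (N + 1) * \<gamma> - \<delta>\<rceil>"

text \<open>Solving the floor equation for \<open>n\<close> gives \<open>u \<le> n < v\<close>.
  Since \<open>N\<close> exceeds \<beta>, \<open>u\<close> is positive, so the constraint
  \<open>n \<ge> 1\<close> is automatic. Two different ceilings express that an integer lies in this
  half-open interval.\<close>

lemma mem_S_iff_hits: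
  assumes "\<alpha> > 0" "of_int N > \<beta>"
  shows "N \<in> S \<alpha> \<beta> \<longleftrightarrow> hits (1 / \<alpha>) (\<beta> / \<alpha>) N"
proof -
  define u where "u = (of_int N - \<beta>) / \<alpha>"
  define v where "v = (of_int (N + 1) - \<beta>) / \<alpha>"
  have u0: "u > 0" using assms by (simp add: u_def)
  have uv: "u < v" using assms by (simp add: u_def v_def divide_strict_right_mono)
  have "N \<in> S \<alpha> \<beta> \<longleftrightarrow> (\<exists>n::int. n \<ge> 1 \<and> N = \<lfloor>\<alpha> * of_int n + \<beta>\<rfloor>)"
    by (auto simp: S_def)
  also have "\<dots> \<longleftrightarrow> (\<exists>n::int. n \<ge> 1 \<and> u \<le> of_int n \<and> of_int n < v)"
    using assms(1) by (intro ex_cong1) (auto simp: u_def v_def field_simps floor_unique eq_commute[of N] floor_eq_iff)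
  also have "\<dots> \<longleftrightarrow> (\<exists>n::int. u \<le> of_int n \<and> of_int n < v)"
  proof (intro ex_cong1)
    fix n :: int
    have "u \<le> of_int n \<Longrightarrow> n \<ge> 1" using u0 by linarith
    then show "(n \<ge> 1 \<and> u \<le> of_int n \<and> of_int n < v) \<longleftrightarrow> (u \<le> of_int n \<and> of_int n < v)" by blast
  qed
  \<comment> \<open>The least integer at or above \<open>u\<close> is the only candidate that has to
    be tested.\<close>
  also have "\<dots> \<longleftrightarrow> of_int \<lceil>u\<rceil> < v"
    by (metis ceiling_le_iff le_of_int_ceiling le_less_trans of_int_le_iff)
  also have "\<dots> \<longleftrightarrow> \<lceil>u\<rceil> \<noteq> \<lceil>v\<rceil>"
    using uv ceiling_mono[of u v] by (auto simp: less_ceiling_iff[symmetric])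
  finally show ?thesis
    by (simp add: hits_def u_def v_def diff_divide_distrib)
qed

text \<open>Breakpoints of height \<open>H\<close> are at least \<open>4 / K\<close> apart, so there are intervals of length \<open>1 / K\<close>
  free of them; the product is the number of steps after which one of these is hit.\<close>

definition window :: "nat \<Rightarrow> nat \<Rightarrow> nat" where
  "window d H = (let K = 4 * H ^ 4 * (1 + 4 * d) in (2 * K * d + 2) * K)"

text \<open>Write \<open>N = D * M + t\<close>. The residue \<open>t\<close> is kept and
  \<open>M\<close> is replaced by some \<open>M'\<close> for which \<open>M' \<surd>d\<close>, up to
  an integer, lies in the same breakpoint-free interval as \<open>M \<surd>d\<close>.\<close>

lemma hits_recur:
  fixes N :: nat
  assumes ns: "\<not> is_square d" and D: "D > 0"
    and G: "\<And>\<gamma> \<delta>. (\<gamma>, \<delta>) \<in> G \<Longrightarrow> \<exists>A B C E :: int. real D * \<gamma> = of_int A + of_int B * sqrt (real d) \<and>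
       real D * \<delta> = of_int C + of_int E * sqrt (real d) \<and> \<bar>B\<bar> \<le> int h \<and> \<bar>E\<bar> \<le> int h"
    and H: "H = (D + 1) * h" "h > 0"
    and N: "N \<ge> D * (H + 1)"
  obtains N' where "D * m \<le> N'" "N' \<le> D * (m + window d H + 1)"
    "\<And>\<gamma> \<delta>. (\<gamma>, \<delta>) \<in> G \<Longrightarrow> hits \<gamma> \<delta> (int N') \<longleftrightarrow> hits \<gamma> \<delta> (int N)"
proof -
  let ?r = "sqrt (real d)"
  define t where "t = N mod D"
  define M where "M = N div D"
  define K where "K = 4 * H ^ 4 * (1 + 4 * d)"
  have HN: "H > 0" using H by simp
  then have K: "K > 0" by (simp add: K_def)
  have "M \<ge> H + 1" using N D unfolding M_def by (simp add: less_eq_div_iff_mult_less_eq mult.commute)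
  then have nb: "real M * ?r \<notin> breakpoints d H" by (intro multiple_not_breakpoint[OF ns]) simp
  have sep: "2 * (1 / real K) < \<bar>z - z'\<bar>" if "z \<in> breakpoints d H" "z' \<in> breakpoints d H" "z \<noteq> z'" for z z'
  proof -
    have "real K = 4 * real (H ^ 4 * (1 + 4 * d))" by (simp add: K_def)
    then have "4 \<le> real K * \<bar>z - z'\<bar>" using breakpoints_separated[OF ns that]
      by (simp only: mult.assoc)
    then have "4 / real K \<le> \<bar>z - z'\<bar>" using K by (simp add: field_simps)
    moreover have "2 * (1 / real K) < 4 / real K" using K by (simp add: field_simps)
    ultimately show ?thesis by linarith
  qed
  obtain a where a: "real M * ?r \<in> {a..a + 1 / real K}" "{a..a + 1 / real K} \<inter> breakpoints d H = {}"
    by (rule separated_gap[OF nb, of "1 / real K"]) (use K sep in auto)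
  obtain M' k where M': "m \<le> M'" "M' \<le> m + window d H" "real M' * ?r + of_int k \<in> {a..a + 1 / real K}"
    using multiples_dense[OF ns K, of m a] unfolding window_def Let_def K_def by metis
  define N' where "N' = D * M' + t"
  have tD: "t < D" using D by (simp add: t_def)
  have hits_iff: "hits \<gamma> \<delta> (int N') \<longleftrightarrow> hits \<gamma> \<delta> (int N)" if mem: "(\<gamma>, \<delta>) \<in> G" for \<gamma> \<delta>
  proof -
    obtain A B C E where AB: "real D * \<gamma> = of_int A + of_int B * ?r"
       "real D * \<delta> = of_int C + of_int E * ?r" "\<bar>B\<bar> \<le> int h" "\<bar>E\<bar> \<le> int h"
      using G[OF mem] by blast
    \<comment> \<open>The bound \<open>s \<le> D\<close> covers both \<open>t\<close> and
      \<open>Suc t\<close>, which are the offsets entering \<open>hits\<close>.\<close>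
    have const: "\<lceil>of_int B * (real M' * ?r + of_int k) + (real s * \<gamma> - \<delta>)\<rceil> =
        \<lceil>of_int B * (real M * ?r) + (real s * \<gamma> - \<delta>)\<rceil>" if s: "s \<le> D" for s
    proof (rule ceiling_constant_on_gap[OF M'(3) a(1)])
      fix z assume B0: "of_int B \<noteq> (0::real)" and z: "z \<in> {a..a + 1 / real K}"
      show "of_int B * z + (real s * \<gamma> - \<delta>) \<notin> \<int>"
      proof
        assume "of_int B * z + (real s * \<gamma> - \<delta>) \<in> \<int>"
        then obtain l where l: "of_int B * z + (real s * \<gamma> - \<delta>) = of_int l" by (auto elim: Ints_cases)
        \<comment> \<open>Multiplying by \<open>D\<close> makes all coordinates integral and
          exhibits \<open>z\<close> as a breakpoint with coefficients \<open>D * B\<close> and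
          \<open>E - s * B\<close>; their size accounts for \<open>H = (D + 1) * h\<close>.\<close>
        have "of_int (int D * B) * z = real D * of_int l - real s * (real D * \<gamma>) + real D * \<delta>"
          unfolding l[symmetric] by (simp add: algebra_simps)
        also have "\<dots> = of_int (int D * l - int s * A + C) + of_int (E - int s * B) * ?r"
          unfolding AB by (simp add: algebra_simps)
        finally have eq: "of_int (int D * B) * z = of_int (int D * l - int s * A + C) + of_int (E - int s * B) * ?r" .
        have "\<bar>int s * B\<bar> \<le> int D * int h" "\<bar>int D * B\<bar> \<le> int D * int h"
          unfolding abs_mult using s AB by (auto intro!: mult_mono)
        then have "\<bar>E - int s * B\<bar> \<le> int H" "\<bar>int D * B\<bar> \<le> int H"
          using AB unfolding H by (auto simp: algebra_simps)
        moreover have "int D * B \<noteq> 0" using B0 D by simp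
        ultimately have "z \<in> breakpoints d H" unfolding breakpoints_def using eq by blast
        then show False using a(2) z by blast
      qed
    qed
    \<comment> \<open>Both the rational part \<open>M0 * A\<close> and the integer shift
      \<open>k0\<close> contribute integers, which can be taken out of the ceiling.\<close>
    have ceil: "\<lceil>of_int (int (D * M0 + s)) * \<gamma> - \<delta>\<rceil> =
        \<lceil>of_int B * (real M0 * ?r + of_int k0) + (real s * \<gamma> - \<delta>)\<rceil> + (int M0 * A - B * k0)" for M0 s k0
    proof -
      have "of_int (int (D * M0 + s)) * \<gamma> - \<delta> = real M0 * (real D * \<gamma>) + (real s * \<gamma> - \<delta>)"
        by (simp add: algebra_simps)
      also have "\<dots> = (of_int B * (real M0 * ?r + of_int k0) + (real s * \<gamma> - \<delta>)) + of_int (int M0 * A - B * k0)"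
        unfolding AB by (simp add: algebra_simps)
      finally show ?thesis by (simp only: ceiling_add_of_int)
    qed
    have N1: "N = D * M + t" by (simp add: M_def t_def)
    have s1: "int (D * M0 + t) + 1 = int (D * M0 + Suc t)" for M0 by simp
    \<comment> \<open>The integers taken out are the same for offsets \<open>t\<close> and
      \<open>Suc t\<close>, so they cancel when the two ceilings are compared.\<close>
    show ?thesis
      unfolding hits_def N1 N'_def s1 ceil[of M' _ k] ceil[of M _ 0]
      using const[of t] const[of "Suc t"] tD by simp
  qed
  have "D * m \<le> N'" using M' by (simp add: N'_def trans_le_add1)
  moreover have "N' \<le> D * (M' + 1)" using tD by (simp add: N'_def)
  then have "N' \<le> D * (m + window d H + 1)" using M'(2) by (meson add_le_mono1 mult_le_mono2 order_trans)
  ultimately show ?thesis using that hits_iff by blast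
qed

text \<open>Recurrence is used in both directions. A bad number in the window would recur
  arbitrarily far out, contradicting eventual covering; a bad number anywhere beyond
  \<open>L\<close> would recur inside the window. The summand \<open>b\<close> of \<open>L\<close>
  places all numbers considered beyond every \<beta>.\<close>

theorem eventual_covering_family_iff_window:
  assumes ns: "\<not> is_square d" and D: "D > 0" and h: "h > 0"
    and P: "\<And>\<alpha> \<beta>. (\<alpha>, \<beta>) \<in> P \<Longrightarrow> \<alpha> > 0 \<and> \<beta> < real b \<and>
       (\<exists>A B C E :: int. real D * (1 / \<alpha>) = of_int A + of_int B * sqrt (real d) \<and>
       real D * (\<beta> / \<alpha>) = of_int C + of_int E * sqrt (real d) \<and> \<bar>B\<bar> \<le> int h \<and> \<bar>E\<bar> \<le> int h)"
    and H: "H = (D + 1) * h" and L: "L = D * (H + 1) + b"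
  shows "eventual_covering_family P \<longleftrightarrow>
    (\<forall>N. L \<le> N \<and> N \<le> D * (L + window d H + 1) \<longrightarrow> (\<exists>!p. p \<in> P \<and> int N \<in> S (fst p) (snd p)))"
proof -
  define good where "good N \<longleftrightarrow> (\<exists>!p. p \<in> P \<and> N \<in> S (fst p) (snd p))" for N :: int
  have recur: "\<exists>N'. m \<le> N' \<and> N' \<le> D * (m + window d H + 1) \<and> (good (int N') \<longleftrightarrow> good (int N))"
    if N: "N \<ge> L" and m: "m \<ge> L" for N m
  proof -
    let ?G = "(\<lambda>(\<alpha>, \<beta>). (1 / \<alpha>, \<beta> / \<alpha>)) ` P"
    have G: "\<exists>A B C E :: int. real D * \<gamma> = of_int A + of_int B * sqrt (real d) \<and>
       real D * \<delta> = of_int C + of_int E * sqrt (real d) \<and> \<bar>B\<bar> \<le> int h \<and> \<bar>E\<bar> \<le> int h"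
      if "(\<gamma>, \<delta>) \<in> ?G" for \<gamma> \<delta>
    proof -
      obtain \<alpha> \<beta> where "(\<alpha>, \<beta>) \<in> P" "\<gamma> = 1 / \<alpha>" "\<delta> = \<beta> / \<alpha>"
        using \<open>(\<gamma>, \<delta>) \<in> ?G\<close> by auto
      then show ?thesis using P[of \<alpha> \<beta>] by blast
    qed
    have NL: "N \<ge> D * (H + 1)" using N L by linarith
    obtain N' where N': "D * m \<le> N'" "N' \<le> D * (m + window d H + 1)"
      "\<And>\<gamma> \<delta>. (\<gamma>, \<delta>) \<in> ?G \<Longrightarrow> hits \<gamma> \<delta> (int N') \<longleftrightarrow> hits \<gamma> \<delta> (int N)"
      by (rule hits_recur[where G = ?G and m = m, OF ns D _ H h NL], erule G, rule that)
    have "1 * m \<le> D * m" using D by (intro mult_le_mono1) simp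
    then have mN: "m \<le> N'" using N'(1) by linarith
    have "int N' \<in> S (fst p) (snd p) \<longleftrightarrow> int N \<in> S (fst p) (snd p)" if p: "p \<in> P" for p
    proof -
      obtain \<alpha> \<beta> where ab: "p = (\<alpha>, \<beta>)" by force
      have pos: "\<alpha> > 0" "\<beta> < real b" using P[of \<alpha> \<beta>] p ab by blast+
      have "b \<le> N" "b \<le> N'" using N m mN L by linarith+
      then have "\<beta> < of_int (int N)" "\<beta> < of_int (int N')" using pos by simp_all
      moreover have "(1 / \<alpha>, \<beta> / \<alpha>) \<in> ?G" using p ab by force
      ultimately show ?thesis using N'(3) pos(1) unfolding ab fst_conv snd_conv by (simp only: mem_S_iff_hits)
    qed
    then have "good (int N') \<longleftrightarrow> good (int N)" unfolding good_def by (intro arg_cong[where f = Ex1]) auto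
    then show ?thesis using N'(2) mN by blast
  qed
  have "eventual_covering_family P \<longleftrightarrow> (\<exists>N\<^sub>0. \<forall>N\<ge>N\<^sub>0. good N)"
    unfolding eventual_covering_family_def good_def ..
  also have "\<dots> \<longleftrightarrow> (\<forall>N. L \<le> N \<and> N \<le> D * (L + window d H + 1) \<longrightarrow> good (int N))"
  proof (intro iffI allI impI)
    fix N assume "\<exists>N\<^sub>0. \<forall>N\<ge>N\<^sub>0. good N" and N: "L \<le> N \<and> N \<le> D * (L + window d H + 1)"
    then obtain N0 where N0: "\<And>N. N \<ge> N0 \<Longrightarrow> good N" by blast
    \<comment> \<open>Starting the window of recurrence beyond \<open>N0\<close> produces a copy of
      \<open>N\<close> in the region already known to be good.\<close>
    obtain N' where N': "max L (nat N0) \<le> N'" "good (int N') \<longleftrightarrow> good (int N)"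
      using recur[of N "max L (nat N0)"] N by auto
    have "N0 \<le> int N'" using N'(1) by linarith
    then show "good (int N)" using N0 N'(2) by blast
  next
    assume *: "\<forall>N. L \<le> N \<and> N \<le> D * (L + window d H + 1) \<longrightarrow> good (int N)"
    have "good N" if N: "N \<ge> int L" for N
    proof -
      obtain N1 where N1: "N = int N1" "N1 \<ge> L"
        using N that[of "nat N"] by (metis int_nat_eq le_nat_iff of_nat_0_le_iff order_trans)
      obtain N' where "L \<le> N'" "N' \<le> D * (L + window d H + 1)" "good (int N') \<longleftrightarrow> good (int N1)"
        using recur[OF N1(2), of L] by blast
      then show ?thesis using * N1(1) by blast
    qed
    then show "\<exists>N\<^sub>0. \<forall>N\<ge>N\<^sub>0. good N" by blast
  qed
  finally show ?thesis unfolding good_def .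
qed

section \<open>Closure properties of the recursive functions\<close>

text \<open>The argument list serves as an environment of de Bruijn variables: \<open>hd\<close> is the innermost bound
  variable, and a term is moved under a binder by composing it with \<open>tl\<close>.\<close>

definition recfun :: "nat \<Rightarrow> (nat list \<Rightarrow> nat) \<Rightarrow> bool" where
  "recfun n f \<longleftrightarrow> (\<exists>r. \<forall>xs. length xs = n \<longrightarrow> rec_eval r xs (f xs))"

lemma recfunI: "(\<And>xs. length xs = n \<Longrightarrow> rec_eval r xs (f xs)) \<Longrightarrow> recfun n f"
  by (auto simp: recfun_def)

lemma recfun_cong:
  assumes "recfun n f" "\<And>xs. length xs = n \<Longrightarrow> g xs = f xs"
  shows "recfun n g"
  using assms unfolding recfun_def by metis

lemma recfun_nth: "i < n \<Longrightarrow> recfun n (\<lambda>xs. xs ! i)"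
  by (rule recfunI[of _ "Proj i"]) (auto intro: rec_eval.Proj)

lemma recfun_comp:
  assumes f: "recfun (length gs) f" and gs: "\<And>g. g \<in> set gs \<Longrightarrow> recfun n g"
  shows "recfun n (\<lambda>xs. f (map (\<lambda>g. g xs) gs))"
proof -
  obtain r where r: "\<And>ys. length ys = length gs \<Longrightarrow> rec_eval r ys (f ys)"
    using f unfolding recfun_def by blast
  have "\<forall>g. \<exists>s. g \<in> set gs \<longrightarrow> (\<forall>xs. length xs = n \<longrightarrow> rec_eval s xs (g xs))"
    using gs unfolding recfun_def by blast
  then obtain s where s: "\<And>g xs. g \<in> set gs \<Longrightarrow> length xs = n \<Longrightarrow> rec_eval (s g) xs (g xs)"
    by metis
  show ?thesis
  proof (rule recfunI)
    fix xs :: "nat list" assume "length xs = n"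
    then show "rec_eval (Comp r (map s gs)) xs (f (map (\<lambda>g. g xs) gs))"
      using s r by (intro rec_eval.Comp[where ys = "map (\<lambda>g. g xs) gs"]) (auto simp: list_all2_conv_all_nth)
  qed
qed

lemma recfun_comp1:
  assumes "recfun 1 (\<lambda>ys. f (hd ys))" "recfun n a"
  shows "recfun n (\<lambda>xs. f (a xs))"
  using recfun_comp[of "[a]" "\<lambda>ys. f (hd ys)" n] assms by simp

lemma recfun_hd: "recfun (Suc n) hd"
  by (rule recfun_cong[OF recfun_nth[of 0]]) (auto simp: length_Suc_conv)

lemma recfun_tl:
  assumes "recfun n f"
  shows "recfun (Suc n) (\<lambda>xs. f (tl xs))"
proof (rule recfun_cong)
  show "recfun (Suc n) (\<lambda>xs. f (map (\<lambda>g. g xs) (map (\<lambda>i xs. xs ! Suc i) [0..<n])))"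
    using assms by (intro recfun_comp) (auto intro: recfun_nth)
  show "f (tl xs) = f (map (\<lambda>g. g xs) (map (\<lambda>i xs. xs ! Suc i) [0..<n]))" if "length xs = Suc n" for xs
  proof -
    have "tl xs = map (\<lambda>g. g xs) (map (\<lambda>i xs. xs ! Suc i) [0..<n])"
      using that by (intro nth_equalityI) (auto simp: nth_tl)
    then show ?thesis by simp
  qed
qed

lemma recfun_Suc:
  assumes "recfun n f"
  shows "recfun n (\<lambda>xs. Suc (f xs))"
proof (rule recfun_comp1[OF _ assms])
  show "recfun 1 (\<lambda>ys. Suc (hd ys))"
    by (rule recfunI[of _ Succ]) (auto simp: length_Suc_conv intro: rec_eval.Succ)
qed

lemma recfun_const: "recfun n (\<lambda>xs. c)"
proof (induction c)
  case 0
  show ?case by (rule recfunI[of _ Zero]) (rule rec_eval.Zero)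
qed (rule recfun_Suc)

lemma recfun_Prec:
  assumes f: "recfun n f" and g: "recfun (Suc (Suc n)) (\<lambda>zs. g (hd zs) (hd (tl zs)) (tl (tl zs)))"
  shows "recfun (Suc n) (\<lambda>zs. rec_nat (f (tl zs)) (\<lambda>k y. g k y (tl zs)) (hd zs))"
proof -
  obtain r s where r: "\<And>xs. length xs = n \<Longrightarrow> rec_eval r xs (f xs)"
    and s: "\<And>zs. length zs = Suc (Suc n) \<Longrightarrow> rec_eval s zs (g (hd zs) (hd (tl zs)) (tl (tl zs)))"
    using f g unfolding recfun_def by blast
  have "rec_eval (Prec r s) (k # xs) (rec_nat (f xs) (\<lambda>k y. g k y xs) k)" if "length xs = n" for k xs
  proof (induction k)
    case 0
    show ?case using r[OF that] by (simp add: rec_eval.Prec_0)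
  next
    case (Suc k)
    then show ?case
      using s[of "k # rec_nat (f xs) (\<lambda>k y. g k y xs) k # xs"] that by (auto intro!: rec_eval.Prec_Suc)
  qed
  then show ?thesis
    by (intro recfunI[of _ "Prec r s"]) (auto simp: length_Suc_conv)
qed

text \<open>Composing the recursion scheme with \<open>b\<close> followed by all projections allows
  any recursive function as iteration count. The step sees the index, the accumulator and the outer
  environment, in this order.\<close>

lemma recfun_rec_nat:
  assumes b: "recfun n b" and f: "recfun n f"
    and g: "recfun (Suc (Suc n)) (\<lambda>zs. g (hd zs) (hd (tl zs)) (tl (tl zs)))"
  shows "recfun n (\<lambda>xs. rec_nat (f xs) (\<lambda>k y. g k y xs) (b xs))"
proof (rule recfun_cong)
  let ?gs = "b # map (\<lambda>i xs. xs ! i) [0..<n]"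
  show "recfun n (\<lambda>xs. (\<lambda>zs. rec_nat (f (tl zs)) (\<lambda>k y. g k y (tl zs)) (hd zs)) (map (\<lambda>g. g xs) ?gs))"
    using recfun_Prec[OF f g] b by (intro recfun_comp) (auto intro: recfun_nth)
  show "rec_nat (f xs) (\<lambda>k y. g k y xs) (b xs) =
      (\<lambda>zs. rec_nat (f (tl zs)) (\<lambda>k y. g k y (tl zs)) (hd zs)) (map (\<lambda>g. g xs) ?gs)" if "length xs = n" for xs
  proof -
    have "map (\<lambda>g. g xs) (map (\<lambda>i xs. xs ! i) [0..<n]) = xs"
      using that by (intro nth_equalityI) auto
    then show ?thesis by simp
  qed
qed

named_theorems recfun_intros

lemmas [recfun_intros] = recfun_const recfun_Suc recfun_hd recfun_tl[OF recfun_hd]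
  recfun_tl[OF recfun_tl[OF recfun_hd]] recfun_tl[OF recfun_tl[OF recfun_tl[OF recfun_hd]]]

lemma recfun_add [recfun_intros]:
  assumes "recfun n a" "recfun n b"
  shows "recfun n (\<lambda>xs. a xs + b xs)"
proof (rule recfun_cong)
  show "recfun n (\<lambda>xs. rec_nat (a xs) (\<lambda>k y. Suc y) (b xs))"
    by (intro recfun_rec_nat recfun_intros assms)
  have "i + j = rec_nat i (\<lambda>k y. Suc y) j" for i j :: nat
    by (induction j) auto
  then show "a xs + b xs = rec_nat (a xs) (\<lambda>k y. Suc y) (b xs)" for xs .
qed

lemma recfun_mult [recfun_intros]:
  assumes "recfun n a" "recfun n b"
  shows "recfun n (\<lambda>xs. a xs * b xs)"
proof (rule recfun_cong)
  show "recfun n (\<lambda>xs. rec_nat 0 (\<lambda>k y. a xs + y) (b xs))"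
    by (intro recfun_rec_nat recfun_intros assms assms[THEN recfun_tl, THEN recfun_tl])
  have "i * j = rec_nat 0 (\<lambda>k y. i + y) j" for i j :: nat
    by (induction j) auto
  then show "a xs * b xs = rec_nat 0 (\<lambda>k y. a xs + y) (b xs)" for xs .
qed

lemma recfun_power [recfun_intros]:
  assumes "recfun n a" "recfun n b"
  shows "recfun n (\<lambda>xs. a xs ^ b xs)"
proof (rule recfun_cong)
  show "recfun n (\<lambda>xs. rec_nat 1 (\<lambda>k y. a xs * y) (b xs))"
    by (intro recfun_rec_nat recfun_intros assms assms[THEN recfun_tl, THEN recfun_tl])
  have "i ^ j = rec_nat 1 (\<lambda>k y. i * y) j" for i j :: nat
    by (induction j) auto
  then show "a xs ^ b xs = rec_nat 1 (\<lambda>k y. a xs * y) (b xs)" for xs .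
qed

lemma recfun_fact [recfun_intros]:
  assumes "recfun n a"
  shows "recfun n (\<lambda>xs. fact (a xs))"
proof (rule recfun_cong)
  show "recfun n (\<lambda>xs. rec_nat 1 (\<lambda>k y. Suc k * y) (a xs))"
    by (intro recfun_rec_nat recfun_intros assms)
  have "fact j = rec_nat 1 (\<lambda>k y. Suc k * y) j" for j :: nat
    by (induction j) auto
  then show "fact (a xs) = rec_nat 1 (\<lambda>k y. Suc k * y) (a xs)" for xs .
qed

lemma recfun_pred:
  assumes "recfun n a"
  shows "recfun n (\<lambda>xs. a xs - 1)"
proof (rule recfun_cong)
  show "recfun n (\<lambda>xs. rec_nat 0 (\<lambda>k y. k) (a xs))"
    by (intro recfun_rec_nat recfun_intros assms)
  have "j - 1 = rec_nat 0 (\<lambda>k y. k) j" for j :: nat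
    by (cases j) auto
  then show "a xs - 1 = rec_nat 0 (\<lambda>k y. k) (a xs)" for xs .
qed

lemma recfun_diff [recfun_intros]:
  assumes "recfun n a" "recfun n b"
  shows "recfun n (\<lambda>xs. a xs - b xs)"
proof (rule recfun_cong)
  show "recfun n (\<lambda>xs. rec_nat (a xs) (\<lambda>k y. y - 1) (b xs))"
    by (intro recfun_rec_nat recfun_pred recfun_intros assms)
  have "i - j = rec_nat i (\<lambda>k y. y - 1) j" for i j :: nat
    by (induction j) auto
  then show "a xs - b xs = rec_nat (a xs) (\<lambda>k y. y - 1) (b xs)" for xs .
qed

lemma recfun_sum [recfun_intros]:
  assumes "recfun n b" "recfun (Suc n) (\<lambda>zs. f (hd zs) (tl zs))"
  shows "recfun n (\<lambda>xs. \<Sum>k<b xs. f k xs)"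
proof (rule recfun_cong)
  \<comment> \<open>The recursion step binds the accumulator between the summation index and the
    environment, so the summand is reindexed to skip that slot.\<close>
  have "recfun (Suc (Suc n)) (\<lambda>zs. f (hd zs) (tl (tl zs)))"
  proof (rule recfun_cong)
    let ?gs = "hd # map (\<lambda>i xs. xs ! Suc (Suc i)) [0..<n]"
    show "recfun (Suc (Suc n)) (\<lambda>zs. (\<lambda>zs. f (hd zs) (tl zs)) (map (\<lambda>g. g zs) ?gs))"
      using assms(2) by (intro recfun_comp) (auto intro: recfun_nth recfun_hd)
    show "f (hd zs) (tl (tl zs)) = (\<lambda>zs. f (hd zs) (tl zs)) (map (\<lambda>g. g zs) ?gs)"
      if "length zs = Suc (Suc n)" for zs
    proof -
      have "tl (tl zs) = map (\<lambda>g. g zs) (map (\<lambda>i xs. xs ! Suc (Suc i)) [0..<n])"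
        using that by (intro nth_equalityI) (auto simp: nth_tl)
      then show ?thesis by simp
    qed
  qed
  note this [recfun_intros]
  show "recfun n (\<lambda>xs. rec_nat 0 (\<lambda>k y. y + f k xs) (b xs))"
    by (intro recfun_rec_nat recfun_intros assms(1))
  have "(\<Sum>k<j. f k xs) = rec_nat 0 (\<lambda>k y. y + f k xs) j" for j xs
    by (induction j) auto
  then show "(\<Sum>k<b xs. f k xs) = rec_nat 0 (\<lambda>k y. y + f k xs) (b xs)" for xs .
qed

text \<open>The hypothesis on \<open>F\<close> ranges over all arities because \<open>F\<close> is
  applied to the accumulator, under the two binders of the recursion step.\<close>

lemma recfun_funpow:
  assumes "recfun n a" "recfun n b" and F: "\<And>m c. recfun m c \<Longrightarrow> recfun m (\<lambda>xs. F (c xs))"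
  shows "recfun n (\<lambda>xs. (F ^^ b xs) (a xs))"
proof (rule recfun_cong)
  show "recfun n (\<lambda>xs. rec_nat (a xs) (\<lambda>k y. F y) (b xs))"
    by (intro recfun_rec_nat F recfun_intros assms)
  have "(F ^^ j) i = rec_nat i (\<lambda>k y. F y) j" for i j :: nat
    by (induction j) auto
  then show "(F ^^ b xs) (a xs) = rec_nat (a xs) (\<lambda>k y. F y) (b xs)" for xs .
qed

section \<open>Decidable predicates and bounded quantifiers\<close>

definition recpred :: "nat \<Rightarrow> (nat list \<Rightarrow> bool) \<Rightarrow> bool" where
  "recpred n P \<longleftrightarrow> recfun n (\<lambda>xs. if P xs then 1 else 0)"

lemma recpred_of_pos:
  assumes "recfun n f" "\<And>xs. P xs \<longleftrightarrow> f xs > 0"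
  shows "recpred n P"
  unfolding recpred_def
proof (rule recfun_cong)
  \<comment> \<open>Truncated subtraction turns every positive value into 1 and keeps 0.\<close>
  show "recfun n (\<lambda>xs. 1 - (1 - f xs))"
    by (intro recfun_intros assms)
qed (use assms(2) in auto)

lemma recpred_le [recfun_intros]:
  assumes "recfun n a" "recfun n b"
  shows "recpred n (\<lambda>xs. a xs \<le> b xs)"
proof (rule recpred_of_pos)
  show "recfun n (\<lambda>xs. Suc (b xs) - a xs)" by (intro recfun_intros assms)
qed auto

lemma recpred_not [recfun_intros]:
  assumes "recpred n P"
  shows "recpred n (\<lambda>xs. \<not> P xs)"
proof (rule recpred_of_pos)
  show "recfun n (\<lambda>xs. 1 - (if P xs then 1 else 0))"
    using assms unfolding recpred_def by (intro recfun_intros)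
qed auto

lemma recpred_conj [recfun_intros]:
  assumes "recpred n P" "recpred n Q"
  shows "recpred n (\<lambda>xs. P xs \<and> Q xs)"
proof (rule recpred_of_pos)
  show "recfun n (\<lambda>xs. (if P xs then 1 else 0) * (if Q xs then 1 else 0))"
    using assms unfolding recpred_def by (intro recfun_intros)
qed auto

lemma recpred_disj [recfun_intros]:
  assumes "recpred n P" "recpred n Q"
  shows "recpred n (\<lambda>xs. P xs \<or> Q xs)"
proof (rule recpred_of_pos)
  show "recfun n (\<lambda>xs. (if P xs then 1 else 0) + (if Q xs then 1 else 0))"
    using assms unfolding recpred_def by (intro recfun_intros)
qed auto

lemma recpred_imp [recfun_intros]:
  assumes "recpred n P" "recpred n Q"
  shows "recpred n (\<lambda>xs. P xs \<longrightarrow> Q xs)"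
  using recpred_disj[OF recpred_not[OF assms(1)] assms(2)] by simp

lemma recpred_eq [recfun_intros]:
  assumes "recfun n a" "recfun n b"
  shows "recpred n (\<lambda>xs. a xs = b xs)"
proof -
  have "recpred n (\<lambda>xs. a xs \<le> b xs \<and> b xs \<le> a xs)" by (intro recfun_intros assms)
  also have "(\<lambda>xs. a xs \<le> b xs \<and> b xs \<le> a xs) = (\<lambda>xs. a xs = b xs)" by auto
  finally show ?thesis .
qed

lemma recpred_bex [recfun_intros]:
  assumes "recfun n b" "recpred (Suc n) (\<lambda>zs. P (hd zs) (tl zs))"
  shows "recpred n (\<lambda>xs. \<exists>k<b xs. P k xs)"
proof (rule recpred_of_pos)
  \<comment> \<open>The number of witnesses below the bound is positive exactly when one
    exists.\<close>
  show "recfun n (\<lambda>xs. \<Sum>k<b xs. if P k xs then 1 else 0)"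
    using assms unfolding recpred_def by (intro recfun_intros)
qed (auto simp: neq0_conv[symmetric] simp del: neq0_conv split: if_splits)

lemma recpred_ball [recfun_intros]:
  assumes "recfun n b" "recpred (Suc n) (\<lambda>zs. P (hd zs) (tl zs))"
  shows "recpred n (\<lambda>xs. \<forall>k<b xs. P k xs)"
proof -
  have "recpred n (\<lambda>xs. \<not> (\<exists>k<b xs. \<not> P k xs))" by (intro recfun_intros assms)
  then show ?thesis by simp
qed

lemma recfun_if [recfun_intros]:
  assumes "recpred n P" "recfun n a" "recfun n b"
  shows "recfun n (\<lambda>xs. if P xs then a xs else b xs)"
proof (rule recfun_cong)
  show "recfun n (\<lambda>xs. (if P xs then 1 else 0) * a xs + (1 - (if P xs then 1 else 0)) * b xs)"
    using assms unfolding recpred_def by (intro recfun_intros)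
qed auto

section \<open>Pairing and its inverse\<close>

lemma recfun_prod_encode [recfun_intros]:
  assumes "recfun n a" "recfun n b"
  shows "recfun n (\<lambda>xs. prod_encode (a xs, b xs))"
proof (rule recfun_cong)
  show "recfun n (\<lambda>xs. (\<Sum>k<Suc (a xs + b xs). k) + a xs)"
    by (intro recfun_intros assms)
  have "triangle j = (\<Sum>k<Suc j. k)" for j
    by (induction j) auto
  then show "prod_encode (a xs, b xs) = (\<Sum>k<Suc (a xs + b xs). k) + a xs" for xs
    by (simp add: prod_encode_def)
qed

text \<open>A bounded search written as a sum: the components of a pair are at most its code, and
  injectivity of the pairing leaves one \<open>k\<close> whose summand can be nonzero.\<close>

lemma recfun_fst_prod_decode [recfun_intros]:
  assumes "recfun n a"
  shows "recfun n (\<lambda>xs. fst (prod_decode (a xs)))"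
proof (rule recfun_cong)
  show "recfun n (\<lambda>xs. \<Sum>k<Suc (a xs). if \<exists>l<Suc (a xs). prod_encode (k, l) = a xs then k else 0)"
    by (intro recfun_intros assms assms[THEN recfun_tl] assms[THEN recfun_tl, THEN recfun_tl])
  have "fst (prod_decode z) = (\<Sum>k<Suc z. if \<exists>l<Suc z. prod_encode (k, l) = z then k else 0)" for z
  proof -
    obtain x y where z: "prod_decode z = (x, y)" by force
    then have e: "z = prod_encode (x, y)" by (metis prod_decode_inverse)
    then have "(\<exists>l<Suc z. prod_encode (k, l) = z) \<longleftrightarrow> k = x" for k
      using le_prod_encode_2[of y x] by (auto simp: less_Suc_eq_le)
    then show ?thesis using e z le_prod_encode_1[of x y] by simp
  qed
  then show "fst (prod_decode (a xs)) = (\<Sum>k<Suc (a xs). if \<exists>l<Suc (a xs). prod_encode (k, l) = a xs then k else 0)" for xs .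
qed

lemma recfun_snd_prod_decode [recfun_intros]:
  assumes "recfun n a"
  shows "recfun n (\<lambda>xs. snd (prod_decode (a xs)))"
proof (rule recfun_cong)
  show "recfun n (\<lambda>xs. \<Sum>k<Suc (a xs). if prod_encode (fst (prod_decode (a xs)), k) = a xs then k else 0)"
    by (intro recfun_intros assms assms[THEN recfun_tl] assms[THEN recfun_tl, THEN recfun_tl])
  have "snd (prod_decode z) = (\<Sum>k<Suc z. if prod_encode (fst (prod_decode z), k) = z then k else 0)" for z
  proof -
    obtain x y where z: "prod_decode z = (x, y)" by force
    then have e: "z = prod_encode (x, y)" by (metis prod_decode_inverse)
    then have "prod_encode (x, k) = z \<longleftrightarrow> k = y" for k by auto
    then show ?thesis using e z le_prod_encode_2[of y x] by simp
  qed
  then show "snd (prod_decode (a xs)) = (\<Sum>k<Suc (a xs). if prod_encode (fst (prod_decode (a xs)), k) = a xs then k else 0)" for xs .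
qed

text \<open>An integer is computed as a difference of two naturals, so that no coding is needed for
  intermediate results.\<close>

definition recint :: "nat \<Rightarrow> (nat list \<Rightarrow> int) \<Rightarrow> bool" where
  "recint n f \<longleftrightarrow> (\<exists>p q. recfun n p \<and> recfun n q \<and> (\<forall>xs. f xs = int (p xs) - int (q xs)))"

lemma recintI: "recfun n p \<Longrightarrow> recfun n q \<Longrightarrow> (\<And>xs. f xs = int (p xs) - int (q xs)) \<Longrightarrow> recint n f"
  unfolding recint_def by blast

lemma recintE:
  assumes "recint n f"
  obtains p q where "recfun n p" "recfun n q" "f = (\<lambda>xs. int (p xs) - int (q xs))"
  using assms unfolding recint_def by blast

lemma recint_of_nat [recfun_intros]: "recfun n f \<Longrightarrow> recint n (\<lambda>xs. int (f xs))"
  by (rule recintI[of n f "\<lambda>_. 0"]) (auto intro: recfun_intros)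

lemma recint_0 [recfun_intros]: "recint n (\<lambda>xs. 0)"
  using recint_of_nat[OF recfun_const[of n 0]] by simp

lemma recint_add [recfun_intros]:
  assumes "recint n f" "recint n g"
  shows "recint n (\<lambda>xs. f xs + g xs)"
proof -
  obtain p q where f: "recfun n p" "recfun n q" "f = (\<lambda>xs. int (p xs) - int (q xs))"
    using assms(1) by (rule recintE)
  obtain p' q' where g: "recfun n p'" "recfun n q'" "g = (\<lambda>xs. int (p' xs) - int (q' xs))"
    using assms(2) by (rule recintE)
  show ?thesis
    by (rule recintI[of n "\<lambda>xs. p xs + p' xs" "\<lambda>xs. q xs + q' xs"])
      (intro recfun_intros f(1,2) g(1,2), intro recfun_intros f(1,2) g(1,2), simp add: f(3) g(3))
qed

lemma recint_diff [recfun_intros]: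
  assumes "recint n f" "recint n g"
  shows "recint n (\<lambda>xs. f xs - g xs)"
proof -
  obtain p q where f: "recfun n p" "recfun n q" "f = (\<lambda>xs. int (p xs) - int (q xs))"
    using assms(1) by (rule recintE)
  obtain p' q' where g: "recfun n p'" "recfun n q'" "g = (\<lambda>xs. int (p' xs) - int (q' xs))"
    using assms(2) by (rule recintE)
  show ?thesis
    by (rule recintI[of n "\<lambda>xs. p xs + q' xs" "\<lambda>xs. q xs + p' xs"])
      (intro recfun_intros f(1,2) g(1,2), intro recfun_intros f(1,2) g(1,2), simp add: f(3) g(3))
qed

lemma recint_mult [recfun_intros]:
  assumes "recint n f" "recint n g"
  shows "recint n (\<lambda>xs. f xs * g xs)"
proof -
  obtain p q where f: "recfun n p" "recfun n q" "f = (\<lambda>xs. int (p xs) - int (q xs))"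
    using assms(1) by (rule recintE)
  obtain p' q' where g: "recfun n p'" "recfun n q'" "g = (\<lambda>xs. int (p' xs) - int (q' xs))"
    using assms(2) by (rule recintE)
  show ?thesis
    by (rule recintI[of n "\<lambda>xs. p xs * p' xs + q xs * q' xs" "\<lambda>xs. p xs * q' xs + q xs * p' xs"])
      (intro recfun_intros f(1,2) g(1,2), intro recfun_intros f(1,2) g(1,2), simp add: f(3) g(3) algebra_simps)
qed

lemma recpred_int_le [recfun_intros]:
  assumes "recint n f" "recint n g"
  shows "recpred n (\<lambda>xs. f xs \<le> g xs)"
proof -
  obtain p q where f: "recfun n p" "recfun n q" "f = (\<lambda>xs. int (p xs) - int (q xs))"
    using assms(1) by (rule recintE)
  obtain p' q' where g: "recfun n p'" "recfun n q'" "g = (\<lambda>xs. int (p' xs) - int (q' xs))"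
    using assms(2) by (rule recintE)
  have "recpred n (\<lambda>xs. p xs + q' xs \<le> p' xs + q xs)"
    by (intro recfun_intros f(1,2) g(1,2))
  also have "(\<lambda>xs. p xs + q' xs \<le> p' xs + q xs) = (\<lambda>xs. f xs \<le> g xs)"
    by (intro ext) (simp add: f(3) g(3), linarith)
  finally show ?thesis .
qed

text \<open>Even codes \<open>2 * y\<close> stand for \<open>y\<close> and odd codes
  \<open>2 * y + 1\<close> for \<open>- (y + 1)\<close>. Each sum finds the relevant half by search
  and vanishes for the other parity.\<close>

lemma recint_int_decode [recfun_intros]:
  assumes "recfun n a"
  shows "recint n (\<lambda>xs. int_decode (a xs))"
proof (rule recintI)
  show "recfun n (\<lambda>xs. \<Sum>k<Suc (a xs). if 2 * k = a xs then k else 0)"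
    "recfun n (\<lambda>xs. \<Sum>k<Suc (a xs). if 2 * k = Suc (a xs) then k else 0)"
    by (intro recfun_intros assms assms[THEN recfun_tl] assms[THEN recfun_tl, THEN recfun_tl])+
  have "int_decode z = int (\<Sum>k<Suc z. if 2 * k = z then k else 0) - int (\<Sum>k<Suc z. if 2 * k = Suc z then k else 0)" for z
  proof (cases "even z")
    case True
    then obtain y where y: "z = 2 * y" by blast
    then have "2 * k = z \<longleftrightarrow> k = y" "2 * k \<noteq> Suc z" for k by presburger+
    then show ?thesis using y by (simp add: int_decode_def sum_decode_def)
  next
    case False
    then obtain y where y: "z = 2 * y + 1" using oddE by blast
    then have "2 * k = Suc z \<longleftrightarrow> k = Suc y" "2 * k \<noteq> z" for k by presburger+
    then show ?thesis using y by (simp add: int_decode_def sum_decode_def)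
  qed
  then show "int_decode (a xs) = int (\<Sum>k<Suc (a xs). if 2 * k = a xs then k else 0) -
      int (\<Sum>k<Suc (a xs). if 2 * k = Suc (a xs) then k else 0)" for xs .
qed

section \<open>The decision procedure\<close>

lemma qf_elem_quotient:
  assumes "quotient_of a = (a1, a2)" "quotient_of b = (b1, b2)"
  shows "qf_elem d (a, b) = (of_int (a1 * b2) + of_int (b1 * a2) * sqrt (real d)) / of_int (a2 * b2)"
proof -
  have ab: "real_of_rat a = of_int a1 / of_int a2" "real_of_rat b = of_int b1 / of_int b2"
    using quotient_of_div[OF assms(1)] quotient_of_div[OF assms(2)] by (simp_all add: of_rat_divide)
  have "a2 > 0" "b2 > 0" using assms by (auto simp: quotient_of_denom_pos)
  then show ?thesis
    unfolding qf_elem_def fst_conv snd_conv ab by (simp add: field_simps)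
qed

lemma qf_elem_eq_0:
  assumes ns: "\<not> is_square d" and "qf_elem d q = 0"
  shows "q = 0"
proof -
  obtain a b where q: "q = (a, b)" by force
  obtain a1 a2 b1 b2 where Q: "quotient_of a = (a1, a2)" "quotient_of b = (b1, b2)" by (meson surj_pair)
  have pos: "a2 > 0" "b2 > 0" using Q by (auto simp: quotient_of_denom_pos)
  have "of_int (a1 * b2) + of_int (b1 * a2) * sqrt (real d) = 0"
    using assms(2) pos unfolding q qf_elem_quotient[OF Q] by simp
  then have "a1 * b2 = 0" "b1 * a2 = 0" using int_coords_eq_0[OF ns] by blast+
  then have "a1 = 0" "b1 = 0" using pos by auto
  then show ?thesis using quotient_of_div[OF Q(1)] quotient_of_div[OF Q(2)] by (simp add: q zero_prod_def)
qed

text \<open>Uniqueness of coordinates is what later allows equality of real pairs to be tested on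
  their codes.\<close>

lemma inj_qf_elem:
  assumes "\<not> is_square d"
  shows "inj (qf_elem d)"
proof (rule injI)
  fix p q assume "qf_elem d p = qf_elem d q"
  then have "qf_elem d (p - q) = 0" by (simp add: qf_elem_def of_rat_diff algebra_simps)
  then show "p = q" using qf_elem_eq_0[OF assms] by fastforce
qed

lemma inj_qf_pair: "\<not> is_square d \<Longrightarrow> inj (qf_pair d)"
  unfolding qf_pair_def by (intro prod.inj_map inj_qf_elem)

text \<open>The sign of \<open>u + v \<surd>d\<close>, decided by comparing squares.\<close>

definition qf_nonneg :: "nat \<Rightarrow> int \<Rightarrow> int \<Rightarrow> bool" where
  "qf_nonneg d u v \<longleftrightarrow> 0 \<le> u \<and> (0 \<le> v \<or> v * v * int d \<le> u * u) \<or> 0 \<le> v \<and> u * u \<le> v * v * int d"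

lemma qf_nonneg_iff: "qf_nonneg d u v \<longleftrightarrow> 0 \<le> of_int u + of_int v * sqrt (real d)"
proof -
  define w where "w = of_int v * sqrt (real d)"
  have sq: "v * v * int d \<le> u * u \<longleftrightarrow> \<bar>w\<bar> \<le> \<bar>of_int u :: real\<bar>"
    "u * u \<le> v * v * int d \<longleftrightarrow> \<bar>of_int u :: real\<bar> \<le> \<bar>w\<bar>"
  proof -
    have "w\<^sup>2 = of_int (v * v * int d)" by (simp add: w_def power2_eq_square)
    moreover have "(of_int u :: real)\<^sup>2 = of_int (u * u)" by (simp add: power2_eq_square)
    ultimately show "v * v * int d \<le> u * u \<longleftrightarrow> \<bar>w\<bar> \<le> \<bar>of_int u :: real\<bar>"
      "u * u \<le> v * v * int d \<longleftrightarrow> \<bar>of_int u :: real\<bar> \<le> \<bar>w\<bar>"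
      by (simp_all only: abs_le_square_iff of_int_le_iff)
  qed
  have "0 \<le> v \<Longrightarrow> 0 \<le> w" "v < 0 \<Longrightarrow> w \<le> 0"
    by (auto simp: w_def mult_nonpos_nonneg)
  then show ?thesis unfolding qf_nonneg_def sq w_def[symmetric] by (cases "0 \<le> v"; cases "0 \<le> u") auto
qed

text \<open>The inequality \<open>N \<le> \<alpha> n + \<beta>\<close> with denominators cleared, \<open>c\<close> being the code of \<open>(\<alpha>, \<beta>)\<close>.\<close>

definition reaches :: "nat \<Rightarrow> nat \<Rightarrow> nat \<Rightarrow> nat \<Rightarrow> bool" where
  "reaches d c n N = (let
     a = fst (prod_decode (fst (prod_decode c))); b = snd (prod_decode (fst (prod_decode c)));
     s = fst (prod_decode (snd (prod_decode c))); t = snd (prod_decode (snd (prod_decode c)));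
     a1 = int_decode (fst (prod_decode a)); a2 = int_decode (snd (prod_decode a));
     b1 = int_decode (fst (prod_decode b)); b2 = int_decode (snd (prod_decode b));
     s1 = int_decode (fst (prod_decode s)); s2 = int_decode (snd (prod_decode s));
     t1 = int_decode (fst (prod_decode t)); t2 = int_decode (snd (prod_decode t))
   in qf_nonneg d (a1 * b2 * (s2 * t2) * int n + s1 * t2 * (a2 * b2) - int N * (a2 * b2 * (s2 * t2)))
        (b1 * a2 * (s2 * t2) * int n + t1 * s2 * (a2 * b2)))"

lemma reaches_iff:
  "reaches d (coord_pair_code p) n N \<longleftrightarrow> real N \<le> fst (qf_pair d p) * real n + snd (qf_pair d p)"
proof -
  obtain a b s t where p: "p = ((a, b), (s, t))" by (metis surj_pair)
  obtain a1 a2 b1 b2 where Q: "quotient_of a = (a1, a2)" "quotient_of b = (b1, b2)" by (meson surj_pair)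
  obtain s1 s2 t1 t2 where R: "quotient_of s = (s1, s2)" "quotient_of t = (t1, t2)" by (meson surj_pair)
  have pos: "a2 > 0" "b2 > 0" "s2 > 0" "t2 > 0" using Q R by (auto simp: quotient_of_denom_pos)
  let ?r = "sqrt (real d)"
  \<comment> \<open>\<open>E\<close> and \<open>G\<close> are positive common denominators for the
    coordinates of \<alpha> and \<beta>; multiplying the inequality by \<open>E * G\<close> leaves
    integers for \<open>qf_nonneg\<close>.\<close>
  define E where "E = a2 * b2"
  define G where "G = s2 * t2"
  have EG: "E > 0" "G > 0" using pos by (simp_all add: E_def G_def)
  have pair: "fst (qf_pair d p) = (of_int (a1 * b2) + of_int (b1 * a2) * ?r) / of_int E"
     "snd (qf_pair d p) = (of_int (s1 * t2) + of_int (t1 * s2) * ?r) / of_int G"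
    by (simp_all add: p qf_pair_def qf_elem_quotient[OF Q] qf_elem_quotient[OF R] E_def G_def)
  have "reaches d (coord_pair_code p) n N \<longleftrightarrow>
    qf_nonneg d (a1 * b2 * G * int n + s1 * t2 * E - int N * (E * G)) (b1 * a2 * G * int n + t1 * s2 * E)"
    by (simp add: reaches_def Let_def p coord_pair_code_def qf_code_def rat_code_def Q R E_def G_def)
  also have "\<dots> \<longleftrightarrow> 0 \<le> of_int (E * G) * (fst (qf_pair d p) * real n + snd (qf_pair d p) - real N)"
  proof -
    have 1: "of_int (E * G) * fst (qf_pair d p) = of_int G * (of_int (a1 * b2) + of_int (b1 * a2) * ?r)"
      "of_int (E * G) * snd (qf_pair d p) = of_int E * (of_int (s1 * t2) + of_int (t1 * s2) * ?r)"
      unfolding pair using EG by (simp_all add: field_simps)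
    have "of_int (E * G) * (fst (qf_pair d p) * real n + snd (qf_pair d p) - real N) =
      (of_int (E * G) * fst (qf_pair d p)) * real n + of_int (E * G) * snd (qf_pair d p) - real N * of_int (E * G)"
      by (simp only: algebra_simps)
    also have "\<dots> = of_int (a1 * b2 * G * int n + s1 * t2 * E - int N * (E * G)) +
        of_int (b1 * a2 * G * int n + t1 * s2 * E) * ?r"
      unfolding 1 by (simp add: algebra_simps)
    finally show ?thesis unfolding qf_nonneg_iff by simp
  qed
  also have "\<dots> \<longleftrightarrow> real N \<le> fst (qf_pair d p) * real n + snd (qf_pair d p)"
  proof -
    have "0 \<le> m * y \<longleftrightarrow> 0 \<le> y" if "m > 0" for m y :: real
      using that by (auto simp: zero_le_mult_iff)
    moreover have "(of_int (E * G) :: real) > 0" using EG by simp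
    ultimately show ?thesis by (simp only: diff_ge_0_iff_ge)
  qed
  finally show ?thesis .
qed

section \<open>Access to the entries of a coded list\<close>

definition tail_code :: "nat \<Rightarrow> nat" where
  "tail_code c = snd (prod_decode (c - 1))"

definition entry_code :: "nat \<Rightarrow> nat \<Rightarrow> nat" where
  "entry_code c i = fst (prod_decode ((tail_code ^^ i) c - 1))"

lemma tail_code_funpow: "(tail_code ^^ i) (list_encode xs) = list_encode (drop i xs)"
proof (induction i)
  case (Suc i)
  \<comment> \<open>The code 0 of the empty list is its own tail, so iterating past the end stays at
    0, in agreement with \<open>tl [] = []\<close>.\<close>
  have "prod_decode 0 = (0, 0)" by (simp add: prod_decode_def prod_decode_aux.simps)
  then have "tail_code (list_encode ys) = list_encode (tl ys)" for ys
    by (cases ys) (auto simp: tail_code_def)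
  then show ?case using Suc by (simp add: tl_drop drop_Suc)
qed simp

text \<open>Serves as the test for a valid position, without computing the length of the
  list.\<close>

lemma tail_code_funpow_eq_0: "(tail_code ^^ i) (list_encode xs) = 0 \<longleftrightarrow> length xs \<le> i"
proof -
  have "list_encode ys = 0 \<longleftrightarrow> ys = []" for ys by (cases ys) auto
  then show ?thesis by (simp add: tail_code_funpow)
qed

lemma entry_code_list_encode: "i < length xs \<Longrightarrow> entry_code (list_encode xs) i = xs ! i"
  unfolding entry_code_def tail_code_funpow by (subst Cons_nth_drop_Suc[symmetric]) simp_all

lemma length_le_list_encode: "length xs \<le> list_encode xs"
proof (induction xs)
  case (Cons x xs)
  then show ?case using le_prod_encode_2[of "list_encode xs" x] by simp
qed simp

lemma member_le_list_encode: "x \<in> set xs \<Longrightarrow> x \<le> list_encode xs"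
proof (induction xs)
  case (Cons y xs)
  then show ?case
    using le_prod_encode_2[of "list_encode xs" y] le_prod_encode_1[of y "list_encode xs"] by auto
qed simp

section \<open>Explicit bounds in terms of the input code\<close>

lemma abs_le_int_encode: "\<bar>z\<bar> \<le> int (int_encode z)"
  by (simp add: int_encode_def sum_encode_def)

text \<open>A crude bound: numerators, denominators and \<open>d\<close> are all at most the input code \<open>x\<close>, and every
  quantity needed below is at most \<open>2 x ^ 7\<close>. Hence \<open>fact (height x)\<close> serves as the common
  denominator \<open>D\<close>.\<close>

definition height :: "nat \<Rightarrow> nat" where
  "height x = (x + 2) ^ 8"

lemma height_bound: "j \<le> 7 \<Longrightarrow> 2 * x ^ j \<le> height x"
proof -
  assume j: "j \<le> 7"
  have "x ^ j \<le> (x + 2) ^ j" by (rule power_mono) auto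
  also have "\<dots> \<le> (x + 2) ^ 7" using j by (intro power_increasing) auto
  finally have "2 * x ^ j \<le> (x + 2) * (x + 2) ^ 7" by (intro mult_mono) auto
  then show ?thesis by (simp add: height_def flip: power_Suc)
qed

lemma abs_mult_le_power:
  fixes a b x :: int
  assumes "\<bar>a\<bar> \<le> x ^ i" "\<bar>b\<bar> \<le> x ^ j"
  shows "\<bar>a * b\<bar> \<le> x ^ (i + j)"
  unfolding abs_mult power_add using assms by (intro mult_mono) auto

lemma coords_le_code:
  assumes "quotient_of q = (m, n)"
  shows "\<bar>m\<bar> \<le> int (rat_code q)" "\<bar>n\<bar> \<le> int (rat_code q)"
  using abs_le_int_encode[of m] abs_le_int_encode[of n]
    le_prod_encode_1[of "int_encode m" "int_encode n"] le_prod_encode_2[of "int_encode n" "int_encode m"]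
  by (auto simp: rat_code_def assms)

text \<open>With \<alpha> = \<open>(A + B \<surd>d) / E\<close> and \<beta> =
  \<open>(C + F \<surd>d) / G\<close>, rationalising gives 1/\<alpha> =
  \<open>E (A - B \<surd>d) / n\<close>, where \<open>n\<close> is the norm of the numerator. Hence
  \<open>n * G\<close> clears the denominators of both 1/\<alpha> and \<beta>/\<alpha>, and it
  divides the factorial \<open>D\<close>.\<close>

lemma pair_bounds:
  assumes ns: "\<not> is_square d" and d: "d \<le> x" and p: "coord_pair_code p \<le> x"
    and qf: "qf_pair d p = (\<alpha>, \<beta>)" and \<alpha>: "\<alpha> > 0" and D: "D = fact (height x)"
  shows "\<bar>\<beta>\<bar> \<le> real (height x)" "1 / \<alpha> \<le> real (height x)"
    "\<exists>A B C E :: int. real D * (1 / \<alpha>) = of_int A + of_int B * sqrt (real d) \<and>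
       real D * (\<beta> / \<alpha>) = of_int C + of_int E * sqrt (real d) \<and>
       \<bar>B\<bar> \<le> int (D * height x) \<and> \<bar>E\<bar> \<le> int (D * height x)"
proof -
  let ?r = "sqrt (real d)"
  obtain a b s t where pp: "p = ((a, b), (s, t))" by (metis surj_pair)
  obtain a1 a2 b1 b2 where Q: "quotient_of a = (a1, a2)" "quotient_of b = (b1, b2)" by (meson surj_pair)
  obtain s1 s2 t1 t2 where R: "quotient_of s = (s1, s2)" "quotient_of t = (t1, t2)" by (meson surj_pair)
  have pos: "a2 > 0" "b2 > 0" "s2 > 0" "t2 > 0" using Q R by (auto simp: quotient_of_denom_pos)
  have "rat_code a \<le> x" "rat_code b \<le> x" "rat_code s \<le> x" "rat_code t \<le> x"
    using p le_prod_encode_1 le_prod_encode_2 unfolding pp coord_pair_code_def qf_code_def fst_conv snd_conv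
    by (meson order_trans)+
  then have le: "\<bar>a1\<bar> \<le> int x ^ 1" "\<bar>a2\<bar> \<le> int x ^ 1" "\<bar>b1\<bar> \<le> int x ^ 1" "\<bar>b2\<bar> \<le> int x ^ 1"
    "\<bar>s1\<bar> \<le> int x ^ 1" "\<bar>s2\<bar> \<le> int x ^ 1" "\<bar>t1\<bar> \<le> int x ^ 1" "\<bar>t2\<bar> \<le> int x ^ 1"
    using coords_le_code[OF Q(1)] coords_le_code[OF Q(2)] coords_le_code[OF R(1)] coords_le_code[OF R(2)]
    by (auto intro: order_trans)
  have x1: "int x \<ge> 1" using le(2) pos by simp
  define E where "E = a2 * b2"
  define G where "G = s2 * t2"
  define A where "A = a1 * b2"
  define B where "B = b1 * a2"
  define C where "C = s1 * t2"
  define F where "F = t1 * s2"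
  have EG: "E > 0" "G > 0" using pos by (simp_all add: E_def G_def)
  have le2: "\<bar>E\<bar> \<le> int x ^ 2" "\<bar>G\<bar> \<le> int x ^ 2" "\<bar>A\<bar> \<le> int x ^ 2" "\<bar>B\<bar> \<le> int x ^ 2" "\<bar>C\<bar> \<le> int x ^ 2" "\<bar>F\<bar> \<le> int x ^ 2"
    unfolding E_def G_def A_def B_def C_def F_def one_add_one[symmetric]
    by (intro abs_mult_le_power le)+
  have dx: "\<bar>int d\<bar> \<le> int x ^ 1" using d by simp
  have alpha: "\<alpha> = (of_int A + of_int B * ?r) / of_int E" and beta: "\<beta> = (of_int C + of_int F * ?r) / of_int G"
    using qf by (simp_all add: pp qf_pair_def qf_elem_quotient[OF Q] qf_elem_quotient[OF R] E_def G_def A_def B_def C_def F_def)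
  define n where "n = A * A - int d * (B * B)"
  have prod: "(of_int A + of_int B * ?r) * (of_int A - of_int B * ?r) = of_int n"
    by (simp add: n_def algebra_simps)
  have nz: "of_int A + of_int B * ?r \<noteq> 0" using \<alpha> alpha by auto
  have nz': "of_int A - of_int B * ?r \<noteq> 0"
    using int_coords_eq_0[OF ns, of A "-B"] nz by auto
  then have n0: "n \<noteq> 0" using prod nz nz' by (metis mult_eq_0_iff of_int_0)
  have inv: "1 / \<alpha> = of_int E * (of_int A - of_int B * ?r) / of_int n"
    unfolding alpha prod[symmetric] using nz' by simp
  have n_le: "\<bar>n\<bar> \<le> 2 * int x ^ 5"
  proof -
    have "\<bar>A * A\<bar> \<le> int x ^ 4" "\<bar>int d * (B * B)\<bar> \<le> int x ^ 5"
      using abs_mult_le_power[OF le2(3) le2(3)] abs_mult_le_power[OF dx abs_mult_le_power[OF le2(4) le2(4)]] by simp_all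
    moreover have "int x ^ 4 \<le> int x ^ 5" using x1 by (intro power_increasing) auto
    ultimately show ?thesis unfolding n_def by linarith
  qed
  have H: "2 * int x ^ j \<le> int (height x)" if "j \<le> 7" for j
    using height_bound[OF that, of x] by (metis of_nat_le_iff of_nat_mult of_nat_numeral of_nat_power)
  have abs_le: "\<bar>of_int u + of_int v * ?r\<bar> \<le> 2 * real x ^ 3" if "\<bar>u\<bar> \<le> int x ^ 2" "\<bar>v\<bar> \<le> int x ^ 2" for u v
  proof -
    have u: "\<bar>of_int u :: real\<bar> \<le> real x ^ 2" "\<bar>of_int v :: real\<bar> \<le> real x ^ 2"
      using that by (metis of_int_abs of_int_le_iff of_int_of_nat_eq of_int_power)+
    have "?r \<le> real x" using sqrt_le_self_nat[of d] d by linarith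
    then have "\<bar>of_int v * ?r\<bar> \<le> real x ^ 2 * real x" unfolding abs_mult using u by (intro mult_mono) auto
    moreover have "real x ^ 2 \<le> real x ^ 3" using x1 by (intro power_increasing) auto
    ultimately show ?thesis using u by (simp add: power2_eq_square power3_eq_cube)
  qed
  have Hr: "2 * real x ^ j \<le> real (height x)" if "j \<le> 7" for j
    using height_bound[OF that, of x] by (metis of_nat_le_iff of_nat_mult of_nat_numeral of_nat_power)
  \<comment> \<open>A nonzero integer denominator never increases the absolute value, so bounding
    numerators suffices.\<close>
  have div_le: "\<bar>u / of_int m\<bar> \<le> \<bar>u\<bar>" if "m \<noteq> 0" for u :: real and m :: int
  proof -
    have "1 \<le> \<bar>m\<bar>" using that by linarith
    then have "1 \<le> \<bar>of_int m :: real\<bar>" by linarith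
    then show ?thesis by (simp add: abs_divide divide_le_eq mult_le_cancel_left1)
  qed
  have "\<bar>\<beta>\<bar> \<le> \<bar>of_int C + of_int F * ?r\<bar>" unfolding beta using EG by (intro div_le) auto
  also have "\<dots> \<le> 2 * real x ^ 3" by (rule abs_le) (use le2 in auto)
  also have "\<dots> \<le> real (height x)" by (rule Hr) auto
  finally show "\<bar>\<beta>\<bar> \<le> real (height x)" .
  have "1 / \<alpha> \<le> \<bar>of_int E * (of_int A - of_int B * ?r)\<bar>"
    unfolding inv using div_le[OF n0] by (meson abs_ge_self order_trans)
  also have "\<dots> = \<bar>of_int E\<bar> * \<bar>of_int A + of_int (- B) * ?r\<bar>" by (simp add: abs_mult)
  also have "\<dots> \<le> real x ^ 2 * (2 * real x ^ 3)"
  proof (rule mult_mono)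
    show "\<bar>of_int E :: real\<bar> \<le> real x ^ 2"
      using le2(1) by (metis of_int_abs of_int_le_iff of_int_of_nat_eq of_int_power)
    show "\<bar>of_int A + of_int (- B) * ?r\<bar> \<le> 2 * real x ^ 3" by (rule abs_le) (use le2 in auto)
  qed auto
  also have "\<dots> = 2 * real x ^ 5" by (simp flip: power_add)
  also have "\<dots> \<le> real (height x)" by (rule Hr) auto
  finally show "1 / \<alpha> \<le> real (height x)" .

  \<comment> \<open>This is the product of highest degree; being nonzero and at most
    \<open>height x\<close>, it divides \<open>fact (height x)\<close>.\<close>
  have "\<bar>n * G\<bar> \<le> 2 * int x ^ 5 * int x ^ 2"
    unfolding abs_mult using n_le le2(2) by (intro mult_mono) auto
  also have "\<dots> = 2 * int x ^ 7" by (simp flip: power_add)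
  also have "\<dots> \<le> int (height x)" by (rule H) auto
  finally have "nat \<bar>n * G\<bar> \<le> height x" by linarith
  moreover have nG: "n * G \<noteq> 0" using n0 EG by simp
  then have "1 \<le> nat \<bar>n * G\<bar>" by linarith
  ultimately have "nat \<bar>n * G\<bar> dvd D" unfolding D by (intro dvd_fact)
  then have "n * G dvd int D" by (simp add: nat_dvd_iff nat_abs_dvd_iff)
  then obtain w where w: "int D = n * G * w" by (auto elim: dvdE)
  have "1 \<le> \<bar>n * G\<bar>" using nG by linarith
  then have "\<bar>w\<bar> * 1 \<le> \<bar>w\<bar> * \<bar>n * G\<bar>" by (intro mult_left_mono) simp_all
  also have "\<dots> = int D" using w by (metis abs_mult abs_of_nat mult.commute)
  finally have wD: "\<bar>w\<bar> \<le> int D" by simp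
  have Dr: "real D = of_int n * of_int G * of_int w" using w by (metis of_int_mult of_int_of_nat_eq)
  define c1 where "c1 = E * G * B"
  define c2 where "c2 = E * (A * F - B * C)"
  have "real D * (1 / \<alpha>) = of_int (w * E * G * A) + of_int (- (w * c1)) * ?r"
    unfolding Dr inv c1_def using n0 by (simp add: field_simps)
  moreover have "real D * (\<beta> / \<alpha>) = of_int (w * E * (A * C - int d * (B * F))) + of_int (w * c2) * ?r"
  proof -
    have "real D * (\<beta> / \<alpha>) = real D * (1 / \<alpha>) * \<beta>" by simp
    also have "\<dots> = of_int w * of_int E * ((of_int A - of_int B * ?r) * (of_int C + of_int F * ?r))"
      unfolding Dr inv beta using n0 EG by (simp add: field_simps)
    also have "(of_int A - of_int B * ?r) * (of_int C + of_int F * ?r) =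
       of_int (A * C - int d * (B * F)) + of_int (A * F - B * C) * ?r"
      by (simp add: algebra_simps)
    finally show ?thesis unfolding c2_def by (simp add: algebra_simps)
  qed
  moreover have "\<bar>- (w * c1)\<bar> \<le> int (D * height x)"
  proof -
    have "\<bar>c1\<bar> \<le> int x ^ 6" unfolding c1_def
      using abs_mult_le_power[OF abs_mult_le_power[OF le2(1,2)] le2(4)] by simp
    also have "\<dots> \<le> 2 * int x ^ 6" by simp
    also have "\<dots> \<le> int (height x)" by (rule H) simp
    finally show ?thesis unfolding abs_minus_cancel abs_mult of_nat_mult using wD by (intro mult_mono) auto
  qed
  moreover have "\<bar>w * c2\<bar> \<le> int (D * height x)"
  proof -
    have "\<bar>A * F\<bar> \<le> int x ^ 4" "\<bar>B * C\<bar> \<le> int x ^ 4"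
      using abs_mult_le_power[OF le2(3,6)] abs_mult_le_power[OF le2(4,5)] by simp_all
    then have "\<bar>A * F - B * C\<bar> \<le> 2 * int x ^ 4" by linarith
    then have "\<bar>c2\<bar> \<le> int x ^ 2 * (2 * int x ^ 4)"
      unfolding c2_def abs_mult using le2(1) by (intro mult_mono) auto
    also have "\<dots> = 2 * int x ^ 6" by (simp flip: power_add)
    also have "\<dots> \<le> int (height x)" by (rule H) simp
    finally show ?thesis unfolding abs_mult of_nat_mult using wD by (intro mult_mono) auto
  qed
  ultimately show "\<exists>A B C E :: int. real D * (1 / \<alpha>) = of_int A + of_int B * ?r \<and>
       real D * (\<beta> / \<alpha>) = of_int C + of_int E * ?r \<and>
       \<bar>B\<bar> \<le> int (D * height x) \<and> \<bar>E\<bar> \<le> int (D * height x)" by blast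
qed

section \<open>The bounded tests and their correctness\<close>

definition member_code :: "nat \<Rightarrow> nat \<Rightarrow> nat \<Rightarrow> nat \<Rightarrow> bool" where
  "member_code x d c N \<longleftrightarrow>
     (\<exists>n<(N + 1 + height x) * height x. 1 \<le> n \<and> reaches d c n N \<and> \<not> reaches d c n (Suc N))"

text \<open>The floor equation splits into two sign tests, for \<open>N\<close> and
  \<open>Suc N\<close>. Since \<open>height x\<close> bounds both the absolute value of \<beta> and
  1/\<alpha>, \<alpha>n + \<beta> < N + 1 forces \<open>n < (N + 1 + height x) * height x\<close>,
  so the bounded search misses nothing.\<close>

lemma member_code_iff:
  assumes "\<not> is_square d" "d \<le> x" "coord_pair_code p \<le> x"
    and qf: "qf_pair d p = (\<alpha>, \<beta>)" and \<alpha>: "\<alpha> > 0"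
  shows "member_code x d (coord_pair_code p) N \<longleftrightarrow> int N \<in> S \<alpha> \<beta>"
proof -
  note b = pair_bounds(1,2)[OF assms refl]
  have r: "reaches d (coord_pair_code p) n N \<and> \<not> reaches d (coord_pair_code p) n (Suc N) \<longleftrightarrow>
      int N = \<lfloor>\<alpha> * real n + \<beta>\<rfloor>" for n
    unfolding reaches_iff qf by (auto simp: floor_eq_iff eq_commute[of "int N"])
  have small: "n < (N + 1 + height x) * height x" if "int N = \<lfloor>\<alpha> * real n + \<beta>\<rfloor>" for n
  proof -
    have "\<alpha> * real n + \<beta> < real N + 1" using that by linarith
    then have "\<alpha> * real n < real (N + 1 + height x)" using b(1) by simp
    then have "real n < real (N + 1 + height x) * (1 / \<alpha>)" using \<alpha> by (simp add: field_simps)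
    also have "\<dots> \<le> real (N + 1 + height x) * real (height x)" using b(2) by (intro mult_left_mono) auto
    finally show ?thesis by (simp only: of_nat_mult[symmetric] of_nat_less_iff)
  qed
  have "member_code x d (coord_pair_code p) N \<longleftrightarrow> (\<exists>n. 1 \<le> n \<and> int N = \<lfloor>\<alpha> * real n + \<beta>\<rfloor>)"
    unfolding member_code_def r using small by blast
  also have "\<dots> \<longleftrightarrow> int N \<in> S \<alpha> \<beta>"
  proof
    assume "\<exists>n. 1 \<le> n \<and> int N = \<lfloor>\<alpha> * real n + \<beta>\<rfloor>"
    then obtain n where "1 \<le> n" "int N = \<lfloor>\<alpha> * real n + \<beta>\<rfloor>" by blast
    then show "int N \<in> S \<alpha> \<beta>" unfolding S_def by (intro CollectI exI[of _ "int n"]) simp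
  next
    assume "int N \<in> S \<alpha> \<beta>"
    then obtain n :: int where "1 \<le> n" "int N = \<lfloor>\<alpha> * of_int n + \<beta>\<rfloor>" unfolding S_def by blast
    then show "\<exists>n. 1 \<le> n \<and> int N = \<lfloor>\<alpha> * real n + \<beta>\<rfloor>" by (intro exI[of _ "nat n"]) simp
  qed
  finally show ?thesis .
qed

text \<open>Uniqueness compares entries, not positions, because a list may repeat a pair while the
  family is a set. The bound \<open>Suc x\<close> suffices when \<open>x\<close> is the input code,
  which is at least the length of the list.\<close>

definition covered_once_code :: "nat \<Rightarrow> nat \<Rightarrow> nat \<Rightarrow> nat \<Rightarrow> bool" where
  "covered_once_code x d l N \<longleftrightarrow>
     (\<exists>i<Suc x. (tail_code ^^ i) l \<noteq> 0 \<and> member_code x d (entry_code l i) N \<and>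
       (\<forall>j<Suc x. (tail_code ^^ j) l \<noteq> 0 \<and> member_code x d (entry_code l j) N \<longrightarrow> entry_code l j = entry_code l i))"

lemma covered_once_code_iff:
  assumes ns: "\<not> is_square d" and x: "x = input_code d ps"
    and pos: "\<And>p. p \<in> set ps \<Longrightarrow> fst (qf_pair d p) > 0"
  shows "covered_once_code x d (list_encode (map coord_pair_code ps)) N \<longleftrightarrow>
    (\<exists>!p. p \<in> qf_pair d ` set ps \<and> int N \<in> S (fst p) (snd p))"
proof -
  let ?l = "list_encode (map coord_pair_code ps)"
  let ?m = "\<lambda>p. int N \<in> S (fst (qf_pair d p)) (snd (qf_pair d p))"
  have dx: "d \<le> x" and lx: "?l \<le> x"
    unfolding x input_code_def by (rule le_prod_encode_1, rule le_prod_encode_2)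
  have len: "length ps < Suc x" using length_le_list_encode[of "map coord_pair_code ps"] lx by simp
  have mem: "member_code x d (coord_pair_code p) N \<longleftrightarrow> ?m p" if "p \<in> set ps" for p
  proof -
    have "coord_pair_code p \<le> x"
      using member_le_list_encode[of "coord_pair_code p" "map coord_pair_code ps"] that lx by auto
    then show ?thesis using member_code_iff[OF ns dx] pos[OF that] by (metis prod.collapse)
  qed
  have key: "(tail_code ^^ i) ?l \<noteq> 0 \<and> member_code x d (entry_code ?l i) N \<longleftrightarrow> i < length ps \<and> ?m (ps ! i)" for i
    by (cases "i < length ps") (simp_all add: tail_code_funpow_eq_0 entry_code_list_encode mem)
  have entry: "entry_code ?l j = entry_code ?l i \<longleftrightarrow> ps ! j = ps ! i" if "i < length ps" "j < length ps" for i j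
    using that by (simp add: entry_code_list_encode)
  have "covered_once_code x d ?l N \<longleftrightarrow>
    (\<exists>i<Suc x. (i < length ps \<and> ?m (ps ! i)) \<and>
      (\<forall>j<Suc x. j < length ps \<and> ?m (ps ! j) \<longrightarrow> entry_code ?l j = entry_code ?l i))"
    unfolding covered_once_code_def key[symmetric] by (simp only: conj_assoc)
  also have "\<dots> \<longleftrightarrow> (\<exists>i<length ps. ?m (ps ! i) \<and> (\<forall>j<length ps. ?m (ps ! j) \<longrightarrow> ps ! j = ps ! i))"
  proof (intro ex_cong1)
    fix i
    have bound: "j < Suc x" if "j < length ps" for j using that len by simp
    have eq: "(\<forall>j<Suc x. j < length ps \<and> M j \<longrightarrow> entry_code ?l j = entry_code ?l i) \<longleftrightarrow>
        (\<forall>j<length ps. M j \<longrightarrow> ps ! j = ps ! i)" if "i < length ps" for M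
      using entry[OF that] bound by meson
    show "i < Suc x \<and> (i < length ps \<and> ?m (ps ! i)) \<and>
        (\<forall>j<Suc x. j < length ps \<and> ?m (ps ! j) \<longrightarrow> entry_code ?l j = entry_code ?l i) \<longleftrightarrow>
      i < length ps \<and> ?m (ps ! i) \<and> (\<forall>j<length ps. ?m (ps ! j) \<longrightarrow> ps ! j = ps ! i)"
      by (cases "i < length ps") (simp_all only: eq bound simp_thms)
  qed
  also have "\<dots> \<longleftrightarrow> (\<exists>p\<in>set ps. ?m p \<and> (\<forall>q\<in>set ps. ?m q \<longrightarrow> q = p))"
  proof -
    have ex: "(\<exists>p\<in>set ps. Q p) \<longleftrightarrow> (\<exists>i<length ps. Q (ps ! i))" for Q
      using all_set_conv_all_nth[of ps "\<lambda>p. \<not> Q p"] by blast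
    show ?thesis by (simp only: ex all_set_conv_all_nth)
  qed
  \<comment> \<open>Injectivity of \<open>qf_pair d\<close> passes from equal coordinates to equal
    real pairs.\<close>
  also have "\<dots> \<longleftrightarrow> (\<exists>p\<in>set ps. ?m p \<and> (\<forall>q\<in>set ps. ?m q \<longrightarrow> qf_pair d q = qf_pair d p))"
    by (simp only: inj_eq[OF inj_qf_pair[OF ns]])
  also have "\<dots> \<longleftrightarrow> (\<exists>!p. p \<in> qf_pair d ` set ps \<and> int N \<in> S (fst p) (snd p))"
    unfolding Ex1_def by blast
  finally show ?thesis .
qed

text \<open>The parameters instantiate the window criterion: \<open>D * height x\<close> is the
  coefficient bound \<open>h\<close> of \<open>pair_bounds\<close>, and
  \<open>Suc (height x)\<close> is a strict upper bound for every \<beta>. The outer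
  \<open>Suc\<close> includes the right end of the window.\<close>

definition covering_code :: "nat \<Rightarrow> bool" where
  "covering_code x = (let
     d = fst (prod_decode x); D = fact (height x); H = (D + 1) * (D * height x);
     L = D * (H + 1) + Suc (height x)
   in \<forall>N<Suc (D * (L + window d H + 1)). L \<le> N \<longrightarrow> covered_once_code x d (snd (prod_decode x)) N)"

lemma covering_code_iff:
  assumes ns: "\<not> is_square d"
    and pos: "\<And>p. p \<in> set ps \<Longrightarrow> fst (qf_pair d p) > 0"
  shows "covering_code (input_code d ps) \<longleftrightarrow> eventual_covering_family (qf_pair d ` set ps)"
proof -
  define x where "x = input_code d ps"
  define D :: nat where "D = fact (height x)"
  define h where "h = D * height x"
  define H where "H = (D + 1) * h"
  define L where "L = D * (H + 1) + Suc (height x)"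
  have D0: "D > 0" by (simp add: D_def)
  then have h0: "h > 0" by (simp add: h_def height_def)
  have dx: "d \<le> x" and lx: "list_encode (map coord_pair_code ps) \<le> x"
    unfolding x_def input_code_def by (rule le_prod_encode_1, rule le_prod_encode_2)
  have covered: "covered_once_code x d (list_encode (map coord_pair_code ps)) N \<longleftrightarrow>
      (\<exists>!p. p \<in> qf_pair d ` set ps \<and> int N \<in> S (fst p) (snd p))" for N
    by (rule covered_once_code_iff[OF ns x_def pos])
  have swap: "(\<forall>N. A N \<and> B N \<longrightarrow> G N) \<longleftrightarrow> (\<forall>N. B N \<longrightarrow> A N \<longrightarrow> G N)" for A B G :: "nat \<Rightarrow> bool"
    by blast
  have "eventual_covering_family (qf_pair d ` set ps) \<longleftrightarrow>
    (\<forall>N. L \<le> N \<and> N \<le> D * (L + window d H + 1) \<longrightarrow>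
      (\<exists>!p. p \<in> qf_pair d ` set ps \<and> int N \<in> S (fst p) (snd p)))"
  proof (rule eventual_covering_family_iff_window[OF ns D0 h0 _ H_def L_def])
    fix \<alpha> \<beta> assume "(\<alpha>, \<beta>) \<in> qf_pair d ` set ps"
    then obtain p where p: "p \<in> set ps" "qf_pair d p = (\<alpha>, \<beta>)" by auto
    have \<alpha>: "\<alpha> > 0" using pos[OF p(1)] p(2) by simp
    have "coord_pair_code p \<le> x"
      using member_le_list_encode[of "coord_pair_code p" "map coord_pair_code ps"] p(1) lx by auto
    note bounds = pair_bounds[OF ns dx this p(2) \<alpha> D_def, folded h_def]
    have "\<beta> < real (Suc (height x))" using bounds(1) by simp
    then show "\<alpha> > 0 \<and> \<beta> < real (Suc (height x)) \<and>
       (\<exists>A B C E :: int. real D * (1 / \<alpha>) = of_int A + of_int B * sqrt (real d) \<and>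
       real D * (\<beta> / \<alpha>) = of_int C + of_int E * sqrt (real d) \<and> \<bar>B\<bar> \<le> int h \<and> \<bar>E\<bar> \<le> int h)"
      using \<alpha> bounds(3) by blast
  qed
  also have "\<dots> \<longleftrightarrow> (\<forall>N<Suc (D * (L + window d H + 1)). L \<le> N \<longrightarrow>
      covered_once_code x d (list_encode (map coord_pair_code ps)) N)"
    by (simp only: covered swap less_Suc_eq_le)
  also have "\<dots> \<longleftrightarrow> covering_code x"
    by (simp only: covering_code_def Let_def x_def[unfolded input_code_def] prod_encode_inverse fst_conv snd_conv
        D_def h_def H_def L_def)
  finally show ?thesis by (simp add: x_def)
qed

section \<open>Computability of the decision procedure\<close>

lemma recpred_reaches [recfun_intros]:
  assumes "recfun n d" "recfun n c" "recfun n k" "recfun n N"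
  shows "recpred n (\<lambda>xs. reaches (d xs) (c xs) (k xs) (N xs))"
  unfolding reaches_def qf_nonneg_def Let_def
  by (intro recfun_intros assms)

lemma recfun_height [recfun_intros]: "recfun n a \<Longrightarrow> recfun n (\<lambda>xs. height (a xs))"
  unfolding height_def by (intro recfun_intros)

lemma recfun_window [recfun_intros]:
  assumes "recfun n d" "recfun n H"
  shows "recfun n (\<lambda>xs. window (d xs) (H xs))"
  unfolding window_def Let_def by (intro recfun_intros assms)

lemma recfun_tail_code_funpow [recfun_intros]:
  assumes "recfun n i" "recfun n c"
  shows "recfun n (\<lambda>xs. (tail_code ^^ i xs) (c xs))"
  by (rule recfun_funpow[OF assms(2,1)]) (unfold tail_code_def, intro recfun_intros)

lemma recfun_entry_code [recfun_intros]:
  assumes "recfun n i" "recfun n c"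
  shows "recfun n (\<lambda>xs. entry_code (c xs) (i xs))"
  unfolding entry_code_def by (intro recfun_intros assms)

lemma recpred_member_code [recfun_intros]:
  assumes "recfun n x" "recfun n d" "recfun n c" "recfun n N"
  shows "recpred n (\<lambda>xs. member_code (x xs) (d xs) (c xs) (N xs))"
  unfolding member_code_def by (intro recfun_intros assms assms[THEN recfun_tl])

lemma recpred_covered_once_code [recfun_intros]:
  assumes "recfun n x" "recfun n d" "recfun n l" "recfun n N"
  shows "recpred n (\<lambda>xs. covered_once_code (x xs) (d xs) (l xs) (N xs))"
  unfolding covered_once_code_def
  by (intro recfun_intros assms assms[THEN recfun_tl] assms[THEN recfun_tl, THEN recfun_tl])

lemma recpred_covering_code: "recpred (Suc 0) (\<lambda>xs. covering_code (hd xs))"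
  unfolding covering_code_def Let_def by (intro recfun_intros)

theorem theorem18:
  shows "\<exists>F :: recf. \<forall>(d :: nat) (P :: (real \<times> real) set) (ps :: coord_pair list).
    \<not> is_square d \<longrightarrow>
    finite P \<longrightarrow> P \<noteq> {} \<longrightarrow>
    (\<forall>(\<alpha>, \<beta>)\<in>P. \<alpha> > 0 \<and> \<alpha> \<in> quadratic_field d \<and> \<beta> \<in> quadratic_field d) \<longrightarrow>
    P = qf_pair d ` set ps \<longrightarrow>
    rec_eval F [input_code d ps] (if eventual_covering_family P then 1 else 0)"
proof -
  \<comment> \<open>\<open>F\<close> computes the characteristic function of
    \<open>covering_code\<close> and is fixed before \<open>d\<close> and \<open>ps\<close>, so one
    algorithm serves all fields and all inputs.\<close>
  obtain F where F: "\<And>xs. length xs = Suc 0 \<Longrightarrow> rec_eval F xs (if covering_code (hd xs) then 1 else 0)"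
    using recpred_covering_code unfolding recpred_def recfun_def by blast
  show ?thesis
  proof (intro exI[of _ F] allI impI)
    fix d and P :: "(real \<times> real) set" and ps
    assume ns: "\<not> is_square d"
      and P: "\<forall>(\<alpha>, \<beta>)\<in>P. \<alpha> > 0 \<and> \<alpha> \<in> quadratic_field d \<and> \<beta> \<in> quadratic_field d"
      and ps: "P = qf_pair d ` set ps"
    have "fst (qf_pair d p) > 0" if "p \<in> set ps" for p
      using P that unfolding ps by (auto simp: case_prod_beta)
    then show "rec_eval F [input_code d ps] (if eventual_covering_family P then 1 else 0)"
      using F[of "[input_code d ps]"] covering_code_iff[OF ns] unfolding ps by simp
  qed
qed

end
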